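(* (1) $|\mathscr{L}^1_{\mathbb Z}|\leq 2^{2^{\aleph_0}}$. (2) $\mathscr{L}^1_{\mathbb Z}$ has an uncountable antichain. (3) There is a strictly increasing proper-class-sized chain in $\mathscr{L}_{\mathbb Z}$. In particular, the lattice $\mathscr{L}_{\mathbb Z}$ is a proper class.
   Context: $\mathbb Z\text{-}\mathrm{Mod}$ is the class of all abelian groups, viewed as structures in the language of $\mathbb Z$-modules. $A\leq B$ means subgroup, $A\leq_\oplus B$ means direct summand. AEC: a pair $\mathcal K=(\mathbf K,\preccurlyeq)$, with $\mathbf K$ a class of $L$-structures and $\preccurlyeq$ a binary relation on $\mathbf K$, such that: (i) $\mathbf K$ and $\preccurlyeq$ are closed under isomorphisms; (ii) $A\preccurlyeq B$ implies $A$ is a substructure of $B$; (iii) $\preccurlyeq$ is a partial order; (iv) if $(A_i)_{i<\delta}$ ($\delta$ limit) is an increasing continuous $\preccurlyeq$-chain in $\mathbf K$, then $A=\bigcup_{i<\delta}A_i\in\mathbf K$, $A_j\preccurlyeq A$ for all $j<\delta$, and if $A_i\preccurlyeq B$ for all $i<\delta$ then $A\preccurlyeq B$; (v) if $A\preccurlyeq C$, $B\preccurlyeq C$ and $A$ is a substructure of $B$ then $A\preccurlyeq B$; (vi) there is a cardinal $\lambda\geq|L|+\aleph_0$ such that for all $B\in\mathbf K$, $X\subseteq B$ there is $A\in\mathbf K$ with $X\subseteq A\preccurlyeq B$ and $|A|\leq|X|+\lambda$. $\mathscr{L}_{\mathbb Z}$ is the class of all binary relations $\preccurlyeq$ on $\mathbb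 Z\text{-}\mathrm{Mod}$ such that $(\mathbb Z\text{-}\mathrm{Mod},\preccurlyeq)$ is an AEC and $A\leq_\oplus B$ implies $A\preccurlyeq B$. It is ordered by reverse inclusion (stronger relations are higher); with this order it is a lattice. Purity: $A\leq_{\mathrm{pp}}B$ iff $A\leq B$ and every finite system of $\mathbb Z$-linear equations with right-hand side in $A$ that is solvable in $B$ is solvable in $A$. $\mathscr{L}^1_{\mathbb Z}=\{\preccurlyeq\,\in\mathscr L_{\mathbb Z}\mid\ \leq_{\mathrm{pp}}\subseteq\preccurlyeq\}$ is the sublattice below purity. *)

theory Defs
  imports "HOL-Algebra.Coset" "HOL-Algebra.FiniteProduct" "HOL-Library.Countable_Set"
begin

unbundle cardinal_syntax

section \<open>A universe of sets\<close>

text \<open>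
  HOL has no proper classes, so the theory is developed inside an arbitrary model of set theory.
  An element of a type \<open>'v\<close> of class \<open>set_universe\<close> is a \<^emph>\<open>set\<close>, and \<open>elts x\<close> is its
  extension. An arbitrary term of type \<open>'v set\<close> is a \<^emph>\<open>class\<close>; the class is a set iff it is
  \<open>elts x\<close> for some \<open>x\<close>. The axioms are those of second-order ZF (separation and replacement
  hold for all classes and class functions); choice is inherited from HOL.
\<close>

class set_universe =
  fixes elts :: "'a \<Rightarrow> 'a set"
  assumes extensionality: "elts x = elts y \<Longrightarrow> x = y"
    and foundation: "wf {(x, y). x \<in> elts y}"
    and separation: "\<exists>y. elts y = {z \<in> elts x. P z}"
    and replacement: "\<exists>y. elts y = f ` elts x"
    and union: "\<exists>y. elts y = (\<Union>z\<in>elts x. elts z)"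
    and powerset: "\<exists>y. elts y = {z. elts z \<subseteq> elts x}"
    and infinity: "\<exists>x. infinite (elts x)"

text \<open>Von Neumann ordinals of the universe; the order on them is membership.\<close>

definition transitive_set :: "'v::set_universe \<Rightarrow> bool" where
  "transitive_set x \<longleftrightarrow> (\<forall>y\<in>elts x. elts y \<subseteq> elts x)"

definition ordinal :: "'v::set_universe \<Rightarrow> bool" where
  "ordinal \<alpha> \<longleftrightarrow> transitive_set \<alpha> \<and> (\<forall>\<beta>\<in>elts \<alpha>. transitive_set \<beta>)"

definition limit_ordinal :: "'v::set_universe \<Rightarrow> bool" where
  "limit_ordinal \<delta> \<longleftrightarrow>
     ordinal \<delta> \<and> elts \<delta> \<noteq> {} \<and> (\<forall>\<alpha>\<in>elts \<delta>. \<exists>\<beta>\<in>elts \<delta>. \<alpha> \<in> elts \<beta>)"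


section \<open>Abelian groups\<close>

text \<open>
  The class of all abelian groups, written multiplicatively as in \<open>HOL-Algebra\<close>: the sum is
  \<open>\<otimes>\<close>, the zero is \<open>\<one>\<close>, and the scalar multiple of \<open>x\<close> by an integer \<open>r\<close> is \<open>x [^] r\<close>. The
  carrier has to be a set of the universe. The record field \<open>mult\<close> is a total function; fixing
  its values off the carrier makes two records equal whenever they describe the same structure,
  which is what antisymmetry of the relations considered below refers to.
\<close>

definition ZMod :: "'v::set_universe monoid set" where
  "ZMod = {G. comm_group G \<and> carrier G \<in> range elts \<and>
              (\<forall>x y. x \<notin> carrier G \<or> y \<notin> carrier G \<longrightarrow> x \<otimes>\<^bsub>G\<^esub> y = undefined)}"

definition submodule_rel :: "'v::set_universe monoid rel" where
  "submodule_rel = {(A, B). A \<in> ZMod \<and> B \<in> ZMod \<and> subgroup (carrier A) B \<and>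
     (\<forall>x\<in>carrier A. \<forall>y\<in>carrier A. x \<otimes>\<^bsub>A\<^esub> y = x \<otimes>\<^bsub>B\<^esub> y)}"

definition summand_rel :: "'v::set_universe monoid rel" where
  "summand_rel = {(A, B). (A, B) \<in> submodule_rel \<and>
     (\<exists>C. (C, B) \<in> submodule_rel \<and> carrier A \<inter> carrier C = {\<one>\<^bsub>B\<^esub>} \<and>
          carrier A <#>\<^bsub>B\<^esub> carrier C = carrier B)}"

text \<open>
  \<open>x\<close> is a solution in \<open>G\<close> of the system of \<open>m\<close> equations
  $\sum_{j<n} r_{ij} x_j = a_i$ in \<open>n\<close> unknowns.
\<close>

definition solves ::
  "'v monoid \<Rightarrow> nat \<Rightarrow> nat \<Rightarrow> (nat \<Rightarrow> nat \<Rightarrow> int) \<Rightarrow> (nat \<Rightarrow> 'v) \<Rightarrow> (nat \<Rightarrow> 'v) \<Rightarrow> bool" where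
  "solves G m n r a x \<longleftrightarrow> (\<forall>j<n. x j \<in> carrier G) \<and>
     (\<forall>i<m. finprod G (\<lambda>j. x j [^]\<^bsub>G\<^esub> r i j) {..<n} = a i)"

definition pure_rel :: "'v::set_universe monoid rel" where
  "pure_rel = {(A, B). (A, B) \<in> submodule_rel \<and>
     (\<forall>m n r a. (\<forall>i<m. a i \<in> carrier A) \<longrightarrow>
        (\<exists>x. solves B m n r a x) \<longrightarrow> (\<exists>x. solves A m n r a x))}"


section \<open>Abstract elementary classes of abelian groups\<close>

text \<open>The union of a family of groups; meaningful if the family is a chain of subgroups.\<close>

definition union_structure :: "('i \<Rightarrow> 'v monoid) \<Rightarrow> 'i set \<Rightarrow> 'v monoid" where
  "union_structure A I =
     \<lparr>carrier = (\<Union>i\<in>I. carrier (A i)),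
      monoid.mult = (\<lambda>x y. if \<exists>i\<in>I. x \<in> carrier (A i) \<and> y \<in> carrier (A i)
                    then THE z. \<exists>i\<in>I. x \<in> carrier (A i) \<and> y \<in> carrier (A i) \<and> z = x \<otimes>\<^bsub>A i\<^esub> y
                    else undefined),
      monoid.one = (THE e. \<exists>i\<in>I. e = \<one>\<^bsub>A i\<^esub>)\<rparr>"

definition continuous_chain ::
  "'v::set_universe monoid rel \<Rightarrow> 'v \<Rightarrow> ('v \<Rightarrow> 'v monoid) \<Rightarrow> bool" where
  "continuous_chain R \<delta> A \<longleftrightarrow>
     (\<forall>j\<in>elts \<delta>. \<forall>i\<in>elts j. (A i, A j) \<in> R) \<and>
     (\<forall>\<gamma>\<in>elts \<delta>. limit_ordinal \<gamma> \<longrightarrow> A \<gamma> = union_structure A (elts \<gamma>))"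

text \<open>
  Abstract elementary classes \<open>(K, R)\<close> in the language of modules over the integers. Of the clauses
  below, the last one is the Loewenheim-Skolem axiom, where the cardinal is represented by a
  set \<open>elts l\<close> of that size; as the language is countable, the cardinal only has
  to be infinite.
\<close>

definition aec :: "'v::set_universe monoid set \<Rightarrow> 'v monoid rel \<Rightarrow> bool" where
  "aec K R \<longleftrightarrow>
     K \<subseteq> ZMod \<and> R \<subseteq> K \<times> K \<and>
     (\<forall>A\<in>K. \<forall>A'\<in>ZMod. A \<cong> A' \<longrightarrow> A' \<in> K) \<and>
     (\<forall>A B A' B' h. (A, B) \<in> R \<longrightarrow> A' \<in> ZMod \<longrightarrow> B' \<in> ZMod \<longrightarrow>
        h \<in> iso B B' \<longrightarrow> h \<in> iso A A' \<longrightarrow> (A', B') \<in> R) \<and>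
     R \<subseteq> submodule_rel \<and>
     partial_order_on K R \<and>
     (\<forall>\<delta> A. limit_ordinal \<delta> \<longrightarrow> (\<forall>i\<in>elts \<delta>. A i \<in> K) \<longrightarrow> continuous_chain R \<delta> A \<longrightarrow>
        union_structure A (elts \<delta>) \<in> K \<and>
        (\<forall>j\<in>elts \<delta>. (A j, union_structure A (elts \<delta>)) \<in> R) \<and>
        (\<forall>B\<in>K. (\<forall>i\<in>elts \<delta>. (A i, B) \<in> R) \<longrightarrow> (union_structure A (elts \<delta>), B) \<in> R)) \<and>
     (\<forall>A B C. (A, C) \<in> R \<longrightarrow> (B, C) \<in> R \<longrightarrow> (A, B) \<in> submodule_rel \<longrightarrow> (A, B) \<in> R) \<and>
     (\<exists>l::'v. infinite (elts l) \<and>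
        (\<forall>B\<in>K. \<forall>X\<subseteq>carrier B. \<exists>A\<in>K.
           X \<subseteq> carrier A \<and> (A, B) \<in> R \<and> |carrier A| \<le>o |X| +c |elts l| ))"


section \<open>The lattice of AEC relations on abelian groups\<close>

definition LZ :: "'v::set_universe monoid rel set" where
  "LZ = {R. aec ZMod R \<and> summand_rel \<subseteq> R}"

text \<open>The order is reverse inclusion: stronger relations are higher.\<close>

definition le_LZ :: "'v::set_universe monoid rel \<Rightarrow> 'v monoid rel \<Rightarrow> bool" where
  "le_LZ R S \<longleftrightarrow> S \<subseteq> R"

definition less_LZ :: "'v::set_universe monoid rel \<Rightarrow> 'v monoid rel \<Rightarrow> bool" where
  "less_LZ R S \<longleftrightarrow> le_LZ R S \<and> R \<noteq> S"

definition LZ1 :: "'v::set_universe monoid rel set" where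
  "LZ1 = {R \<in> LZ. pure_rel \<subseteq> R}"

end

theory Submission
  imports Defs "HOL-Algebra.Elementary_Groups" "HOL-Computational_Algebra.Primes"
begin

text \<open>
  A relation \<open>R\<close> containing purity is determined by the pairs of countable groups in it.
  If \<open>(A, B)\<close> is in \<open>R\<close>, then every countable pure subgroup of \<open>A\<close> is contained in a countable pure
  subgroup of \<open>B\<close>, and the two are in relation by coherence. Conversely, \<open>A\<close> is the union of a continuous
  chain of smaller pure subgroups; inductively these are in relation to \<open>B\<close>, and the union axiom
  gives it for \<open>A\<close> (\<open>pure_hull_rel\<close>, \<open>LZ1_determined_by_countable\<close>). As there are at most $2^{\<aleph>_0}$
  countable pairs up to isomorphism, there are at most $2^{2^{\<aleph>_0}}$ relations (\<open>card_LZ1\<close>).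

  Both the antichain and the long chain consist of \<^emph>\<open>isotype\<close> relations: \<open>A\<close> is related to
  \<open>B\<close> if $A \<inter> p^{w+1} B = p^{w+1} A$ for all \<open>(p, w)\<close> in an index set closed under taking
  smaller ordinals \<open>w\<close>. Divisibility is preserved by homomorphisms, which gives most of the axioms
  and the inclusion of summands; a witness of divisibility is a single element, which gives the
  axioms on unions and on small substructures (\<open>isotype_rel_in_LZ\<close>).

  For the antichain only \<open>w = 0\<close> is used. Sets of primes then yield relations that contain purity, and the subgroup
  $p\mathbb{Z}$ of $\mathbb{Z}$ shows that inclusion of the relations reverses inclusion of
  the sets of primes. There are uncountably many pairwise incomparable sets of primes.

  For the chain, \<open>p = 2\<close> and \<open>w\<close> ranges over the ordinals below \<open>\<alpha>\<close>. The relations get stronger with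
  \<open>\<alpha>\<close>; they never stabilise (\<open>ex_stronger_ulm_rel\<close>): otherwise all of them would have a common Loewenheim-Skolem
  number, and a reduced group of very large Ulm length would have a small subgroup of equally large Ulm length,
  although the length of a reduced group is bounded in terms of its cardinality. Reduced groups of
  arbitrarily large length are constructed from well-founded trees (\<open>tree_group\<close>).
\<close>

section \<open>Closing a set under finitary operations\<close>

lemma finite_card_le_infinite: "finite A \<Longrightarrow> infinite K \<Longrightarrow> |A| \<le>o |K|"
  by (meson card_of_ordLeq_finite ordLeq_total card_of_Well_order)

lemma card_lists_le:
  fixes K :: "'k set" and A :: "'a set"
  assumes inf: "infinite K" and A: "|A| \<le>o |K|"
  shows "|lists A| \<le>o |K|"
proof -
  have n: "|{xs \<in> lists A. length xs = n}| \<le>o |K|" for n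
  proof (induction n)
    case 0
    have "{xs \<in> lists A. length xs = 0} \<subseteq> {[]}" by auto
    then have "finite {xs \<in> lists A. length xs = 0}" using finite_subset by blast
    then show ?case using inf by (rule finite_card_le_infinite)
  next
    case (Suc n)
    have "{xs \<in> lists A. length xs = Suc n} \<subseteq>
        (\<lambda>(x, xs). x # xs) ` (A \<times> {xs \<in> lists A. length xs = n})"
    proof
      fix xs assume "xs \<in> {xs \<in> lists A. length xs = Suc n}"
      then show "xs \<in> (\<lambda>(x, xs). x # xs) ` (A \<times> {xs \<in> lists A. length xs = n})"
        by (cases xs) auto
    qed
    then have "|{xs \<in> lists A. length xs = Suc n}| \<le>o |A \<times> {xs \<in> lists A. length xs = n}|"
      by (rule surj_imp_ordLeq)
    also have "|A \<times> {xs \<in> lists A. length xs = n}| \<le>o |K|"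
      by (rule card_of_Sigma_ordLeq_infinite[OF inf A]) (use Suc in simp)
    finally show ?case .
  qed
  have "lists A = (\<Union>n\<in>(UNIV::nat set). {xs \<in> lists A. length xs = n})" by auto
  moreover have "|\<Union>n\<in>(UNIV::nat set). {xs \<in> lists A. length xs = n}| \<le>o |K|"
    using n inf by (intro card_of_UNION_ordLeq_infinite) (auto simp: infinite_iff_card_of_nat)
  ultimately show ?thesis by simp
qed

inductive_set fun_closure :: "('a list \<Rightarrow> 'a) set \<Rightarrow> 'a set \<Rightarrow> 'a set"
  for F :: "('a list \<Rightarrow> 'a) set" and X :: "'a set" where
  base: "x \<in> X \<Longrightarrow> x \<in> fun_closure F X"
| step: "f \<in> F \<Longrightarrow> \<forall>x\<in>set xs. x \<in> fun_closure F X \<Longrightarrow> f xs \<in> fun_closure F X"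

lemma fun_closure_mono: "X \<subseteq> Y \<Longrightarrow> fun_closure F X \<subseteq> fun_closure F Y"
proof
  fix x assume "X \<subseteq> Y" "x \<in> fun_closure F X"
  from this(2,1) show "x \<in> fun_closure F Y"
    by induction (auto intro: fun_closure.intros)
qed

lemma fun_closure_subset:
  assumes "X \<subseteq> C" "\<And>f xs. f \<in> F \<Longrightarrow> set xs \<subseteq> C \<Longrightarrow> f xs \<in> C"
  shows "fun_closure F X \<subseteq> C"
proof
  fix x assume "x \<in> fun_closure F X"
  then show "x \<in> C"
    by induction (use assms(1) in blast, use assms(2) in \<open>metis subsetI\<close>)
qed

lemma fun_closure_card_le:
  fixes K :: "'k set"
  assumes inf: "infinite K" and X: "|X| \<le>o |K|" and F: "|F| \<le>o |K|"
  shows "|fun_closure F X| \<le>o |K|"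
proof -
  define S where "S Y = Y \<union> (\<lambda>(f, xs). f xs) ` (F \<times> lists Y)" for Y
  define Z where "Z n = (S ^^ n) X" for n
  have Z: "|Z n| \<le>o |K|" for n
  proof (induction n)
    case 0
    then show ?case using X by (simp add: Z_def)
  next
    case (Suc n)
    have "|(\<lambda>(f, xs). f xs) ` (F \<times> lists (Z n))| \<le>o |F \<times> lists (Z n)|" by (rule card_of_image)
    also have "|F \<times> lists (Z n)| \<le>o |K|"
      by (rule card_of_Sigma_ordLeq_infinite[OF inf F]) (use card_lists_le[OF inf Suc] in simp)
    finally have "|(\<lambda>(f, xs). f xs) ` (F \<times> lists (Z n))| \<le>o |K|" .
    then have "|S (Z n)| \<le>o |K|"
      unfolding S_def using inf Suc
      by (intro card_of_Un_ordLeq_infinite_Field) (simp_all only: Field_card_of card_of_card_order_on not_False_eq_True)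
    then show ?case by (simp add: Z_def)
  qed
  have mono: "Z m \<subseteq> Z n" if "m \<le> n" for m n
    using that by (induction rule: dec_induct) (auto simp: Z_def S_def)
  have "fun_closure F X \<subseteq> (\<Union>n. Z n)"
  proof (rule fun_closure_subset)
    show "X \<subseteq> (\<Union>n. Z n)" by (metis UN_upper UNIV_I Z_def funpow_0)
  next
    fix f xs assume f: "f \<in> F" and xs: "set xs \<subseteq> (\<Union>n. Z n)"
    have "\<exists>n. set xs \<subseteq> Z n"
      using xs
    proof (induction xs)
      case (Cons x xs)
      then obtain m n where "x \<in> Z m" "set xs \<subseteq> Z n" by auto
      then have "set (x # xs) \<subseteq> Z (max m n)"
        using mono[of m "max m n"] mono[of n "max m n"] by auto
      then show ?case ..
    qed auto
    then obtain n where "set xs \<subseteq> Z n" ..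
    then have "f xs \<in> Z (Suc n)" using f by (force simp: Z_def S_def)
    then show "f xs \<in> (\<Union>n. Z n)" by blast
  qed
  then have "|fun_closure F X| \<le>o |\<Union>n. Z n|" by (rule card_of_mono1)
  also have "|\<Union>n. Z n| \<le>o |K|"
    using Z inf by (intro card_of_UNION_ordLeq_infinite) (auto simp: infinite_iff_card_of_nat)
  finally show ?thesis .
qed

lemma fun_closure_UN:
  assumes ne: "I \<noteq> {}"
    and dir: "\<And>i j. i \<in> I \<Longrightarrow> j \<in> I \<Longrightarrow> \<exists>k\<in>I. X i \<subseteq> X k \<and> X j \<subseteq> X k"
  shows "fun_closure F (\<Union>i\<in>I. X i) = (\<Union>i\<in>I. fun_closure F (X i))"
proof
  show "fun_closure F (\<Union>i\<in>I. X i) \<subseteq> (\<Union>i\<in>I. fun_closure F (X i))"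
  proof (rule fun_closure_subset)
    fix f xs assume f: "f \<in> F" and xs: "set xs \<subseteq> (\<Union>i\<in>I. fun_closure F (X i))"
    have "\<exists>i\<in>I. set xs \<subseteq> fun_closure F (X i)"
      using xs
    proof (induction xs)
      case (Cons x xs)
      then obtain i j where ij: "i \<in> I" "x \<in> fun_closure F (X i)" "j \<in> I" "set xs \<subseteq> fun_closure F (X j)"
        by auto
      then obtain k where "k \<in> I" "X i \<subseteq> X k" "X j \<subseteq> X k" using dir by blast
      then have "set (x # xs) \<subseteq> fun_closure F (X k)"
        using ij fun_closure_mono[of "X i" "X k" F] fun_closure_mono[of "X j" "X k" F] by auto
      then show ?case using \<open>k \<in> I\<close> by blast
    qed (use ne in auto)
    then show "f xs \<in> (\<Union>i\<in>I. fun_closure F (X i))"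
      using f by (blast intro: fun_closure.step)
  qed (auto intro: fun_closure.base)
next
  show "(\<Union>i\<in>I. fun_closure F (X i)) \<subseteq> fun_closure F (\<Union>i\<in>I. X i)"
    using fun_closure_mono by (metis UN_least UN_upper)
qed

section \<open>Ordinals of the universe\<close>

definition small :: "'v::set_universe set \<Rightarrow> bool" where
  "small A \<longleftrightarrow> A \<in> range elts"

lemma small_elts [simp]: "small (elts x)"
  by (simp add: small_def)

lemma smallI: "elts x = A \<Longrightarrow> small A"
  unfolding small_def by blast

lemma smallE:
  assumes "small A" obtains x where "elts x = A"
  using assms unfolding small_def by blast

lemma small_SOME:
  assumes "small A" shows "elts (SOME z. elts z = A) = A"
proof -
  obtain x where "elts x = A" using assms by (rule smallE)
  then show ?thesis by (rule someI)
qed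

lemma small_subset: "small A \<Longrightarrow> B \<subseteq> A \<Longrightarrow> small B"
proof -
  assume "small A" and BA: "B \<subseteq> A"
  then obtain x where "elts x = A" by (metis smallE)
  moreover obtain y where "elts y = {z \<in> elts x. z \<in> B}" using separation[of x "\<lambda>z. z \<in> B"] by blast
  ultimately have "elts y = B" using BA by auto
  then show ?thesis by (rule smallI)
qed

lemma small_empty [simp]: "small {}"
  by (rule small_subset[OF small_elts empty_subsetI])

lemma small_image:
  fixes f :: "'v::set_universe \<Rightarrow> 'v"
  shows "small A \<Longrightarrow> small (f ` A)"
proof -
  assume "small A"
  then obtain x where "elts x = A" by (metis smallE)
  moreover obtain y where "elts y = f ` elts x" using replacement by blast
  ultimately show ?thesis using smallI by blast
qed

lemma small_UN:
  fixes A :: "'v::set_universe \<Rightarrow> 'v set"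
  assumes "small I" "\<And>i. i \<in> I \<Longrightarrow> small (A i)"
  shows "small (\<Union>i\<in>I. A i)"
proof -
  define f where "f i = (SOME z. elts z = A i)" for i
  have f: "elts (f i) = A i" if "i \<in> I" for i
    unfolding f_def by (rule small_SOME) (rule assms(2)[OF that])
  obtain y where y: "elts y = f ` I" using smallE[OF small_image[OF assms(1), of f]] by blast
  obtain z where "elts z = (\<Union>w\<in>elts y. elts w)" using union by blast
  then have "elts z = (\<Union>i\<in>I. A i)" unfolding y by (simp add: f)
  then show ?thesis by (rule smallI)
qed

lemma small_Pow:
  obtains y :: "'v::set_universe" where "|Pow (elts (x::'v))| \<le>o |elts y|"
proof -
  obtain y where y: "elts y = {z. elts z \<subseteq> elts x}" using powerset by blast
  define f where "f S = (SOME z. elts z = S)" for S :: "'v set"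
  have f: "elts (f S) = S" if "S \<subseteq> elts x" for S
    unfolding f_def by (rule small_SOME) (rule small_subset[OF small_elts that])
  have "inj_on f (Pow (elts x))" by (rule inj_onI) (metis f PowD)
  moreover have "f ` Pow (elts x) \<subseteq> elts y" using f y by auto
  ultimately have "|Pow (elts x)| \<le>o |elts y|" using card_of_ordLeq by blast
  then show thesis by (rule that)
qed

lemma small_Un: "small A \<Longrightarrow> small B \<Longrightarrow> small (A \<union> B :: 'v::set_universe set)"
proof -
  assume A: "small A" and B: "small B"
  obtain x :: 'v where x: "infinite (elts x)" using infinity by blast
  then obtain a b where ab: "a \<in> elts x" "b \<in> elts x" "a \<noteq> b"
    by (metis (full_types) finite.emptyI finite_insert finite_subset insertI1 insert_iff subsetI)
  have "small (\<Union>i\<in>{a, b}. if i = a then A else B)"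
    by (rule small_UN) (use A B ab small_subset[of "elts x" "{a, b}"] in auto)
  moreover have "(\<Union>i\<in>{a, b}. if i = a then A else B) = A \<union> B" using ab by auto
  ultimately show ?thesis by simp
qed

lemma small_insert: "small A \<Longrightarrow> small (insert (a :: 'v::set_universe) A)"
proof -
  assume A: "small A"
  obtain x :: 'v where "infinite (elts x)" using infinity by blast
  then obtain b where "b \<in> elts x" by fastforce
  then have "small ((\<lambda>_. a) ` elts x)" "(\<lambda>_. a) ` elts x = {a}" by (auto intro: small_image)
  then show ?thesis using A small_Un[of "{a}" A] by simp
qed

lemma ordinal_memD: "ordinal \<alpha> \<Longrightarrow> \<beta> \<in> elts \<alpha> \<Longrightarrow> ordinal \<beta>"
  unfolding ordinal_def transitive_set_def by (meson subsetD)

lemma ordinal_trans: "ordinal \<alpha> \<Longrightarrow> \<beta> \<in> elts \<alpha> \<Longrightarrow> \<gamma> \<in> elts \<beta> \<Longrightarrow> \<gamma> \<in> elts \<alpha>"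
  unfolding ordinal_def transitive_set_def by (meson subsetD)

lemma ordinal_linear:
  "ordinal \<alpha> \<Longrightarrow> ordinal \<beta> \<Longrightarrow> \<alpha> \<in> elts \<beta> \<or> \<alpha> = \<beta> \<or> \<beta> \<in> elts (\<alpha>::'v::set_universe)"
proof (induction \<alpha> arbitrary: \<beta> rule: wf_induct_rule[OF foundation])
  case (1 \<alpha>)
  have IHa: "\<alpha>' \<in> elts \<beta> \<or> \<alpha>' = \<beta> \<or> \<beta> \<in> elts \<alpha>'" if "\<alpha>' \<in> elts \<alpha>" "ordinal \<beta>" for \<alpha>' \<beta>
    using 1 that ordinal_memD by blast
  from \<open>ordinal \<beta>\<close> show ?case
  proof (induction \<beta> rule: wf_induct_rule[OF foundation])
    case (1 \<beta>)
    have IHb: "\<alpha> \<in> elts \<beta>' \<or> \<alpha> = \<beta>' \<or> \<beta>' \<in> elts \<alpha>" if "\<beta>' \<in> elts \<beta>" for \<beta>'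
      using 1 that ordinal_memD by blast
    show ?case
    proof (rule ccontr)
      assume no: "\<not> ?case"
      have "elts \<alpha> = elts \<beta>"
      proof (rule equalityI; rule subsetI)
        fix x assume "x \<in> elts \<alpha>"
        then show "x \<in> elts \<beta>"
          using IHa[of x \<beta>] no 1(2) ordinal_trans[OF \<open>ordinal \<alpha>\<close>] by blast
      next
        fix x assume "x \<in> elts \<beta>"
        then show "x \<in> elts \<alpha>"
          using IHb[of x] no ordinal_trans[OF 1(2)] by blast
      qed
      then show False using extensionality no by blast
    qed
  qed
qed

lemma ordinal_UN:
  fixes f :: "'v::set_universe \<Rightarrow> 'v"
  assumes "small I" "\<And>i. i \<in> I \<Longrightarrow> ordinal (f i)"
  obtains \<sigma> where "ordinal \<sigma>" "elts \<sigma> = (\<Union>i\<in>I. elts (f i))"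
proof -
  obtain \<sigma> where \<sigma>: "elts \<sigma> = (\<Union>i\<in>I. elts (f i))"
    using smallE[OF small_UN[OF assms(1), of "\<lambda>i. elts (f i)"]] by auto
  have "ordinal \<sigma>"
    unfolding ordinal_def transitive_set_def \<sigma>
  proof (intro conjI ballI)
    fix y assume "y \<in> (\<Union>i\<in>I. elts (f i))"
    then obtain i where i: "i \<in> I" "y \<in> elts (f i)" by blast
    then show "elts y \<subseteq> (\<Union>i\<in>I. elts (f i))" using ordinal_trans[OF assms(2)] by blast
    fix z assume "z \<in> elts y"
    then show "elts z \<subseteq> elts y"
      using i ordinal_trans[OF ordinal_memD[OF assms(2)]] by blast
  qed
  then show thesis using \<sigma> that by blast
qed

lemma ordinal_succ:
  assumes "ordinal \<alpha>"
  obtains \<sigma> where "ordinal \<sigma>" "elts \<sigma> = insert \<alpha> (elts \<alpha>)"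
proof -
  obtain \<sigma> where \<sigma>: "elts \<sigma> = insert \<alpha> (elts \<alpha>)"
    using smallE[OF small_insert[of "elts \<alpha>" \<alpha>]] by auto
  then have "ordinal \<sigma>"
    using assms unfolding ordinal_def transitive_set_def by auto
  then show thesis using \<sigma> that by blast
qed

text \<open>
  The Mostowski collapse of a well-ordered set. It provides the universe with ordinals of every size
  that its sets have.
\<close>

lemma mostowski_collapse:
  fixes X :: "'v::set_universe set" and r :: "'v rel"
  assumes wo: "well_order_on X r" and X: "small X"
  obtains \<delta> :: 'v and f where "ordinal \<delta>" "bij_betw f X (elts \<delta>)"
    "\<And>a. a \<in> X \<Longrightarrow> elts (f a) = f ` underS r a"
proof -
  define s where "s = r - Id"
  have wf: "wf s" using wo by (simp add: s_def well_order_on_def)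
  define H where "H g a = (SOME z. elts z = g ` underS r a)" for g :: "'v \<Rightarrow> 'v" and a
  define f where "f = wfrec s H"
  have Fld: "Field r = X" using wo well_order_on_Field by blast
  have wo_rel: "wo_rel r" using wo by (simp add: wo_rel_def well_order_on_Well_order)
  have under: "underS r a \<subseteq> X" for a using Fld by (auto simp: underS_def Field_def)
  have H: "elts (H g a) = g ` underS r a" for g a
  proof -
    have "small (g ` underS r a)" by (intro small_image small_subset[OF X under])
    then show ?thesis unfolding H_def by (rule small_SOME)
  qed
  have f: "elts (f a) = f ` underS r a" for a
  proof -
    have "f a = H (cut f s a) a" unfolding f_def by (rule wfrec[OF wf])
    then have "elts (f a) = cut f s a ` underS r a" using H by simp
    also have "\<dots> = f ` underS r a"
      by (rule image_cong) (auto simp: underS_def s_def cut_def)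
    finally show ?thesis .
  qed
  have trans: "a \<in> underS r c" if "a \<in> underS r b" "b \<in> underS r c" for a b c
    using that wo_rel.TRANS[OF wo_rel] wo_rel.ANTISYM[OF wo_rel]
    unfolding underS_def trans_def antisym_def by blast
  have tr: "transitive_set (f a)" for a
    unfolding transitive_set_def f using trans f by auto
  have inj: "inj_on f X"
  proof (rule inj_onI, rule ccontr)
    fix a b assume ab: "a \<in> X" "b \<in> X" "f a = f b" "a \<noteq> b"
    then have "a \<in> underS r b \<or> b \<in> underS r a"
      using wo_rel.TOTAL[OF wo_rel] Fld unfolding total_on_def underS_def by blast
    then have "f a \<in> elts (f b) \<or> f b \<in> elts (f a)" using f by blast
    then have "f a \<in> elts (f a)" using ab by simp
    then show False using foundation[THEN wf_not_refl, of "f a"] by simp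
  qed
  obtain \<delta> where \<delta>: "elts \<delta> = f ` X" using smallE[OF small_image[OF X, of f]] by blast
  have "ordinal \<delta>"
    unfolding ordinal_def transitive_set_def \<delta>
  proof (intro conjI)
    show "\<forall>y\<in>f ` X. elts y \<subseteq> f ` X" using f under by (metis (no_types) imageE image_mono)
    show "\<forall>\<beta>\<in>f ` X. \<forall>y\<in>elts \<beta>. elts y \<subseteq> elts \<beta>" using tr unfolding transitive_set_def by blast
  qed
  then show thesis using that[of \<delta> f] inj \<delta> f by (simp add: bij_betw_def)
qed

lemma ex_large_ordinal:
  obtains \<gamma> :: "'v::set_universe" where "ordinal \<gamma>" "|elts (x::'v)| <o |elts \<gamma>|"
proof -
  obtain y :: 'v where y: "|Pow (elts x)| \<le>o |elts y|" using small_Pow by blast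
  obtain \<gamma> :: 'v and f where \<gamma>: "ordinal \<gamma>" "bij_betw f (elts y) (elts \<gamma>)"
    by (rule mostowski_collapse[OF card_of_well_order_on[of "elts y"] small_elts]) (rule that)
  have "|elts x| <o |elts y|" using card_of_Pow y ordLess_ordLeq_trans by blast
  moreover have "|elts y| =o |elts \<gamma>|" using \<gamma>(2) card_of_ordIso by blast
  ultimately have "|elts x| <o |elts \<gamma>|" using ordLess_ordIso_trans by blast
  then show thesis using that \<gamma> by blast
qed

lemma ex_infinite_ge:
  obtains l :: "'v::set_universe" where "infinite (elts l)" "|elts (x::'v)| \<le>o |elts l|"
proof -
  obtain z :: 'v where z: "infinite (elts z)" using infinity by blast
  obtain l where l: "elts l = elts x \<union> elts z"
    using smallE[OF small_Un[of "elts x" "elts z"]] by auto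
  show thesis by (rule that[of l]) (use l z in \<open>auto intro: card_of_mono1\<close>)
qed

section \<open>Abelian groups and their subgroups\<close>

text \<open>
  The only structure that an abelian group can have on a given subgroup, with the values of the
  multiplication off the carrier normalised as the definition of \<^const>\<open>ZMod\<close> demands.
\<close>

definition induced :: "'a monoid \<Rightarrow> 'a set \<Rightarrow> 'a monoid" where
  "induced G C = \<lparr>carrier = C,
     monoid.mult = (\<lambda>x y. if x \<in> C \<and> y \<in> C then x \<otimes>\<^bsub>G\<^esub> y else undefined),
     monoid.one = \<one>\<^bsub>G\<^esub>\<rparr>"

lemma induced_simps [simp]:
  "carrier (induced G C) = C"
  "\<one>\<^bsub>induced G C\<^esub> = \<one>\<^bsub>G\<^esub>"
  "x \<in> C \<Longrightarrow> y \<in> C \<Longrightarrow> x \<otimes>\<^bsub>induced G C\<^esub> y = x \<otimes>\<^bsub>G\<^esub> y"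
  by (auto simp: induced_def)

lemma ZMod_comm_group: "G \<in> ZMod \<Longrightarrow> comm_group G"
  by (simp add: ZMod_def)

lemma ZMod_group: "G \<in> ZMod \<Longrightarrow> group G"
  by (simp add: ZMod_def comm_group_def)

lemma ZMod_small: "G \<in> ZMod \<Longrightarrow> small (carrier G)"
  by (simp add: ZMod_def small_def)

lemma comm_group_induced:
  assumes "comm_group G" "subgroup C G"
  shows "comm_group (induced G C)"
proof -
  interpret G: comm_group G by fact
  interpret C: subgroup C G by fact
  show ?thesis
  proof (rule comm_groupI)
    fix x assume "x \<in> carrier (induced G C)"
    then show "\<exists>y\<in>carrier (induced G C). y \<otimes>\<^bsub>induced G C\<^esub> x = \<one>\<^bsub>induced G C\<^esub>"
      by (intro bexI[of _ "inv\<^bsub>G\<^esub> x"]) auto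
  qed (auto simp: G.m_assoc intro: G.m_comm)
qed

lemma submodule_relD:
  assumes "(A, B) \<in> submodule_rel"
  shows "A \<in> ZMod" "B \<in> ZMod" "subgroup (carrier A) B" "carrier A \<subseteq> carrier B"
    "x \<in> carrier A \<Longrightarrow> y \<in> carrier A \<Longrightarrow> x \<otimes>\<^bsub>A\<^esub> y = x \<otimes>\<^bsub>B\<^esub> y"
  using assms by (auto simp: submodule_rel_def dest: subgroup.subset)

lemma submodule_relI:
  assumes A: "A \<in> ZMod" and B: "B \<in> ZMod" and sub: "carrier A \<subseteq> carrier B"
    and m: "\<And>x y. x \<in> carrier A \<Longrightarrow> y \<in> carrier A \<Longrightarrow> x \<otimes>\<^bsub>A\<^esub> y = x \<otimes>\<^bsub>B\<^esub> y"
  shows "(A, B) \<in> submodule_rel" "\<one>\<^bsub>A\<^esub> = \<one>\<^bsub>B\<^esub>"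
proof -
  interpret A: group A using A by (rule ZMod_group)
  interpret B: group B using B by (rule ZMod_group)
  have "\<one>\<^bsub>A\<^esub> \<otimes>\<^bsub>B\<^esub> \<one>\<^bsub>A\<^esub> = \<one>\<^bsub>A\<^esub>" using m[of "\<one>\<^bsub>A\<^esub>" "\<one>\<^bsub>A\<^esub>"] by simp
  then show one: "\<one>\<^bsub>A\<^esub> = \<one>\<^bsub>B\<^esub>" using sub by (metis A.one_closed B.l_cancel_one subsetD)
  have "subgroup (carrier A) B"
  proof (rule B.subgroupI)
    fix a assume a: "a \<in> carrier A"
    have "inv\<^bsub>B\<^esub> a = inv\<^bsub>A\<^esub> a"
    proof (rule B.inv_equality)
      show "inv\<^bsub>A\<^esub> a \<otimes>\<^bsub>B\<^esub> a = \<one>\<^bsub>B\<^esub>" using m[of "inv\<^bsub>A\<^esub> a" a] a one by simp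
    qed (use a sub in auto)
    then show "inv\<^bsub>B\<^esub> a \<in> carrier A" using a by simp
  next
    fix a b assume "a \<in> carrier A" "b \<in> carrier A"
    then show "a \<otimes>\<^bsub>B\<^esub> b \<in> carrier A" using m by (metis A.m_closed)
  qed (use sub A.one_closed in auto)
  then show "(A, B) \<in> submodule_rel" using m A B by (simp add: submodule_rel_def)
qed

lemma submodule_rel_one: "(A, B) \<in> submodule_rel \<Longrightarrow> \<one>\<^bsub>A\<^esub> = \<one>\<^bsub>B\<^esub>"
  by (rule submodule_relI(2)) (fact submodule_relD)+

lemma submodule_rel_induced:
  assumes "(A, B) \<in> submodule_rel" shows "A = induced B (carrier A)"
proof (rule monoid.equality)
  show "monoid.mult A = monoid.mult (induced B (carrier A))"
    using submodule_relD(1,5)[OF assms] by (auto simp: induced_def ZMod_def fun_eq_iff)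
qed (use submodule_rel_one[OF assms] in auto)

lemma induced_submodule_rel:
  assumes B: "B \<in> ZMod" and C: "subgroup C B"
  shows "(induced B C, B) \<in> submodule_rel"
proof -
  have "small C" using small_subset[OF ZMod_small[OF B] subgroup.subset[OF C]] .
  then have "induced B C \<in> ZMod"
    using comm_group_induced[OF ZMod_comm_group[OF B] C]
    unfolding ZMod_def by (auto simp: small_def induced_def)
  then show ?thesis using B C by (simp add: submodule_rel_def)
qed

lemma submodule_rel_refl: "A \<in> ZMod \<Longrightarrow> (A, A) \<in> submodule_rel"
  by (simp add: submodule_rel_def ZMod_group group.subgroup_self)

lemma submodule_rel_antisym:
  assumes "(A, B) \<in> submodule_rel" "(B, A) \<in> submodule_rel" shows "A = B"
proof -
  have "carrier A = carrier B" using assms submodule_relD(4) by blast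
  then show ?thesis
    using submodule_rel_induced[OF assms(1)]
      submodule_rel_induced[OF submodule_rel_refl[OF submodule_relD(2)[OF assms(1)]]] by simp
qed

lemma submodule_rel_within:
  assumes A: "(A, C) \<in> submodule_rel" and B: "(B, C) \<in> submodule_rel"
    and AB: "carrier A \<subseteq> carrier B"
  shows "(A, B) \<in> submodule_rel"
proof (rule submodule_relI)
  show "x \<otimes>\<^bsub>A\<^esub> y = x \<otimes>\<^bsub>B\<^esub> y" if "x \<in> carrier A" "y \<in> carrier A" for x y
    using that AB submodule_relD(5)[OF A] submodule_relD(5)[OF B] by (metis subsetD)
qed (use submodule_relD[OF A] submodule_relD[OF B] AB in auto)

lemma submodule_rel_trans:
  assumes AB: "(A, B) \<in> submodule_rel" and BC: "(B, C) \<in> submodule_rel"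
  shows "(A, C) \<in> submodule_rel"
proof (rule submodule_relI)
  show "x \<otimes>\<^bsub>A\<^esub> y = x \<otimes>\<^bsub>C\<^esub> y" if "x \<in> carrier A" "y \<in> carrier A" for x y
    using that submodule_relD(4,5)[OF AB] submodule_relD(5)[OF BC] by (metis subsetD)
qed (use submodule_relD[OF AB] submodule_relD[OF BC] in auto)

lemma submodule_rel_hom:
  assumes "(A, B) \<in> submodule_rel" shows "(\<lambda>x. x) \<in> hom A B"
  using submodule_relD[OF assms] by (auto simp: hom_def)

lemma submodule_rel_nat_pow:
  assumes "(A, B) \<in> submodule_rel" "x \<in> carrier A"
  shows "x [^]\<^bsub>A\<^esub> (n::nat) = x [^]\<^bsub>B\<^esub> n"
  using hom_nat_pow[OF submodule_rel_hom[OF assms(1)] assms(2)] submodule_relD[OF assms(1)] ZMod_group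
  by metis

lemma hom_finprod:
  assumes "comm_group G" "comm_group H" "h \<in> hom G H" "\<And>j. j \<in> J \<Longrightarrow> x j \<in> carrier G"
  shows "h (finprod G x J) = finprod H (\<lambda>j. h (x j)) J"
proof -
  interpret G: comm_group G by fact
  interpret H: comm_group H by fact
  interpret h: group_hom G H h using assms by unfold_locales
  show ?thesis
    using assms(4)
  proof (induction J rule: infinite_finite_induct)
    case (insert j J)
    then have "x \<in> J \<rightarrow> carrier G" "(\<lambda>j. h (x j)) \<in> J \<rightarrow> carrier H" by auto
    then show ?case using insert by (simp add: G.finprod_closed)
  qed auto
qed

lemma solves_cong:
  assumes "comm_group G" and x: "solves G m n r a x"
    and r: "\<And>i j. i < m \<Longrightarrow> j < n \<Longrightarrow> r i j = r' i j" and a: "\<And>i. i < m \<Longrightarrow> a i = a' i"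
  shows "solves G m n r' a' x"
proof -
  interpret G: comm_group G by fact
  have "finprod G (\<lambda>j. x j [^]\<^bsub>G\<^esub> r' i j) {..<n} = finprod G (\<lambda>j. x j [^]\<^bsub>G\<^esub> r i j) {..<n}" if "i < m" for i
    using x r that by (intro G.finprod_cong') (auto simp: solves_def)
  then show ?thesis using x a by (simp add: solves_def)
qed

lemma solves_submodule:
  assumes AB: "(A, B) \<in> submodule_rel" and x: "solves B m n r a x"
    and xA: "\<And>j. j < n \<Longrightarrow> x j \<in> carrier A"
  shows "solves A m n r a x"
proof -
  interpret A: comm_group A using AB submodule_relD ZMod_comm_group by blast
  interpret B: comm_group B using AB submodule_relD ZMod_comm_group by blast
  have "finprod A (\<lambda>j. x j [^]\<^bsub>A\<^esub> r i j) {..<n} = finprod B (\<lambda>j. x j [^]\<^bsub>B\<^esub> r i j) {..<n}" for i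
  proof -
    have "finprod A (\<lambda>j. x j [^]\<^bsub>A\<^esub> r i j) {..<n} = finprod B (\<lambda>j. x j [^]\<^bsub>A\<^esub> r i j) {..<n}"
      by (rule hom_finprod[OF A.comm_group_axioms B.comm_group_axioms submodule_rel_hom[OF AB]])
        (use xA in auto)
    also have "\<dots> = finprod B (\<lambda>j. x j [^]\<^bsub>B\<^esub> r i j) {..<n}"
      using xA submodule_relD(4)[OF AB]
        hom_int_pow[OF submodule_rel_hom[OF AB] _ A.is_group B.is_group]
      by (intro B.finprod_cong') auto
    finally show ?thesis .
  qed
  then show ?thesis using x xA by (simp add: solves_def)
qed

lemma summand_rel_projection:
  assumes "(A, B) \<in> summand_rel"
  obtains \<pi> where "\<pi> \<in> hom B A" "\<And>a. a \<in> carrier A \<Longrightarrow> \<pi> a = a"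
proof -
  obtain C where AB: "(A, B) \<in> submodule_rel" and CB: "(C, B) \<in> submodule_rel"
    and int: "carrier A \<inter> carrier C = {\<one>\<^bsub>B\<^esub>}" and prod: "carrier A <#>\<^bsub>B\<^esub> carrier C = carrier B"
    using assms by (auto simp: summand_rel_def)
  interpret A: comm_group A using AB submodule_relD ZMod_comm_group by blast
  interpret B: comm_group B using AB submodule_relD ZMod_comm_group by blast
  interpret SA: subgroup "carrier A" B using AB submodule_relD by blast
  interpret SC: subgroup "carrier C" B using CB submodule_relD by blast
  have uniq: "a = a'" if "a \<in> carrier A" "a' \<in> carrier A" "c \<in> carrier C" "c' \<in> carrier C"
    "a \<otimes>\<^bsub>B\<^esub> c = a' \<otimes>\<^bsub>B\<^esub> c'" for a a' c c'
  proof -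
    have cl: "a \<in> carrier B" "a' \<in> carrier B" "c \<in> carrier B" "c' \<in> carrier B"
      using that SA.subset SC.subset by auto
    have "inv\<^bsub>B\<^esub> a' \<otimes>\<^bsub>B\<^esub> a = inv\<^bsub>B\<^esub> a' \<otimes>\<^bsub>B\<^esub> (a \<otimes>\<^bsub>B\<^esub> c) \<otimes>\<^bsub>B\<^esub> inv\<^bsub>B\<^esub> c"
      using cl by (simp add: B.m_assoc)
    also have "\<dots> = inv\<^bsub>B\<^esub> a' \<otimes>\<^bsub>B\<^esub> (a' \<otimes>\<^bsub>B\<^esub> c') \<otimes>\<^bsub>B\<^esub> inv\<^bsub>B\<^esub> c" using that by simp
    also have "\<dots> = c' \<otimes>\<^bsub>B\<^esub> inv\<^bsub>B\<^esub> c"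
      using cl by (simp add: B.m_assoc[symmetric])
    finally have "inv\<^bsub>B\<^esub> a' \<otimes>\<^bsub>B\<^esub> a \<in> carrier A \<inter> carrier C" using that by (metis IntI SA.m_closed SA.m_inv_closed SC.m_closed SC.m_inv_closed)
    then have "inv\<^bsub>B\<^esub> a' \<otimes>\<^bsub>B\<^esub> a = \<one>\<^bsub>B\<^esub>" using int by auto
    then show ?thesis using cl by (metis B.inv_equality B.inv_inv B.inv_closed)
  qed
  define \<pi> where "\<pi> b = (THE a. a \<in> carrier A \<and> (\<exists>c\<in>carrier C. b = a \<otimes>\<^bsub>B\<^esub> c))" for b
  have \<pi>: "\<pi> (a \<otimes>\<^bsub>B\<^esub> c) = a" if "a \<in> carrier A" "c \<in> carrier C" for a c
    unfolding \<pi>_def by (rule the_equality) (use that uniq in blast)+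
  have ex: "\<exists>a\<in>carrier A. \<exists>c\<in>carrier C. b = a \<otimes>\<^bsub>B\<^esub> c" if "b \<in> carrier B" for b
    using that unfolding prod[symmetric] set_mult_def by blast
  have "\<pi> \<in> hom B A"
  proof (rule homI)
    fix b assume "b \<in> carrier B"
    then show "\<pi> b \<in> carrier A" using ex \<pi> by metis
  next
    fix b b' assume "b \<in> carrier B" "b' \<in> carrier B"
    then obtain a c a' c' where *: "a \<in> carrier A" "c \<in> carrier C" "b = a \<otimes>\<^bsub>B\<^esub> c"
      "a' \<in> carrier A" "c' \<in> carrier C" "b' = a' \<otimes>\<^bsub>B\<^esub> c'" using ex by metis
    then have cl: "a \<in> carrier B" "a' \<in> carrier B" "c \<in> carrier B" "c' \<in> carrier B"
      using SA.subset SC.subset by auto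
    have "b \<otimes>\<^bsub>B\<^esub> b' = (a \<otimes>\<^bsub>B\<^esub> a') \<otimes>\<^bsub>B\<^esub> (c \<otimes>\<^bsub>B\<^esub> c')"
      using cl * by (simp add: B.m_ac)
    then show "\<pi> (b \<otimes>\<^bsub>B\<^esub> b') = \<pi> b \<otimes>\<^bsub>A\<^esub> \<pi> b'"
      using * \<pi> submodule_relD(5)[OF AB] by simp
  qed
  moreover have "\<pi> a = a" if "a \<in> carrier A" for a
    using \<pi>[OF that SC.one_closed] that SA.subset by (metis B.r_one subsetD)
  ultimately show thesis by (rule that)
qed

section \<open>Directed unions\<close>

text \<open>
  Every continuous chain occurring in the axioms of an abstract elementary class is directed, and
  directedness is all that the arguments about unions need: finitely many elements of the union
  lie in one member of the family.
\<close>

locale directed_family =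
  fixes A :: "'v::set_universe \<Rightarrow> 'v monoid" and I :: "'v set"
  assumes small: "small I" and nonempty: "I \<noteq> {}"
    and directed: "\<And>i j. i \<in> I \<Longrightarrow> j \<in> I \<Longrightarrow>
      \<exists>k\<in>I. (A i, A k) \<in> submodule_rel \<and> (A j, A k) \<in> submodule_rel"
begin

abbreviation "U \<equiv> union_structure A I"

lemma member: "i \<in> I \<Longrightarrow> A i \<in> ZMod"
  using directed submodule_relD(1) by blast

lemma carrier_union: "carrier U = (\<Union>i\<in>I. carrier (A i))"
  by (simp add: union_structure_def)

lemma mult_union:
  assumes "i \<in> I" "x \<in> carrier (A i)" "y \<in> carrier (A i)"
  shows "x \<otimes>\<^bsub>U\<^esub> y = x \<otimes>\<^bsub>A i\<^esub> y"
proof -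
  have "(THE z. \<exists>j\<in>I. x \<in> carrier (A j) \<and> y \<in> carrier (A j) \<and> z = x \<otimes>\<^bsub>A j\<^esub> y) = x \<otimes>\<^bsub>A i\<^esub> y"
  proof (rule the_equality)
    fix z assume "\<exists>j\<in>I. x \<in> carrier (A j) \<and> y \<in> carrier (A j) \<and> z = x \<otimes>\<^bsub>A j\<^esub> y"
    then obtain j where j: "j \<in> I" "x \<in> carrier (A j)" "y \<in> carrier (A j)" "z = x \<otimes>\<^bsub>A j\<^esub> y" by blast
    obtain k where "(A i, A k) \<in> submodule_rel" "(A j, A k) \<in> submodule_rel"
      using directed assms(1) j(1) by blast
    then show "z = x \<otimes>\<^bsub>A i\<^esub> y" using assms j by (metis submodule_relD(5))
  qed (use assms in blast)
  then show ?thesis using assms by (auto simp: union_structure_def)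
qed

lemma one_union:
  assumes "i \<in> I" shows "\<one>\<^bsub>U\<^esub> = \<one>\<^bsub>A i\<^esub>"
proof -
  have "(THE e. \<exists>j\<in>I. e = \<one>\<^bsub>A j\<^esub>) = \<one>\<^bsub>A i\<^esub>"
  proof (rule the_equality)
    fix e assume "\<exists>j\<in>I. e = \<one>\<^bsub>A j\<^esub>"
    then show "e = \<one>\<^bsub>A i\<^esub>" using directed assms submodule_rel_one by metis
  qed (use assms in blast)
  then show ?thesis by (simp add: union_structure_def)
qed

lemma common2:
  assumes "x \<in> carrier U" "y \<in> carrier U"
  obtains k where "k \<in> I" "x \<in> carrier (A k)" "y \<in> carrier (A k)"
proof -
  obtain i j where "i \<in> I" "x \<in> carrier (A i)" "j \<in> I" "y \<in> carrier (A j)"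
    using assms carrier_union by auto
  moreover from this obtain k where "k \<in> I" "(A i, A k) \<in> submodule_rel" "(A j, A k) \<in> submodule_rel"
    using directed by blast
  ultimately show thesis using that submodule_relD(4) by blast
qed

lemma common3:
  assumes "x \<in> carrier U" "y \<in> carrier U" "z \<in> carrier U"
  obtains k where "k \<in> I" "x \<in> carrier (A k)" "y \<in> carrier (A k)" "z \<in> carrier (A k)"
proof -
  obtain i where i: "i \<in> I" "x \<in> carrier (A i)" "y \<in> carrier (A i)" using common2 assms by blast
  obtain j where j: "j \<in> I" "z \<in> carrier (A j)" using assms carrier_union by auto
  obtain k where "k \<in> I" "(A i, A k) \<in> submodule_rel" "(A j, A k) \<in> submodule_rel"
    using directed i j by blast
  then show thesis using that submodule_relD(4) i j by blast
qed

lemma union_in_ZMod: "U \<in> ZMod"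
proof -
  have gr: "comm_group (A i)" if "i \<in> I" for i using that member ZMod_comm_group by blast
  have UI: "x \<in> carrier U" if "i \<in> I" "x \<in> carrier (A i)" for i x
    using that carrier_union by auto
  have "comm_group U"
  proof (rule comm_groupI)
    fix x y assume "x \<in> carrier U" "y \<in> carrier U"
    then obtain k where k: "k \<in> I" "x \<in> carrier (A k)" "y \<in> carrier (A k)" by (rule common2)
    interpret K: comm_group "A k" using gr k by blast
    show "x \<otimes>\<^bsub>U\<^esub> y \<in> carrier U" "x \<otimes>\<^bsub>U\<^esub> y = y \<otimes>\<^bsub>U\<^esub> x"
      using k UI by (simp_all add: mult_union K.m_comm)
  next
    obtain k where k: "k \<in> I" using nonempty by blast
    interpret K: comm_group "A k" using gr k by blast
    show "\<one>\<^bsub>U\<^esub> \<in> carrier U" using one_union[OF k] UI[OF k K.one_closed] by simp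
  next
    fix x y z assume "x \<in> carrier U" "y \<in> carrier U" "z \<in> carrier U"
    then obtain k where k: "k \<in> I" "x \<in> carrier (A k)" "y \<in> carrier (A k)" "z \<in> carrier (A k)"
      by (rule common3)
    interpret K: comm_group "A k" using gr k by blast
    show "x \<otimes>\<^bsub>U\<^esub> y \<otimes>\<^bsub>U\<^esub> z = x \<otimes>\<^bsub>U\<^esub> (y \<otimes>\<^bsub>U\<^esub> z)"
      using k by (simp add: mult_union[OF k(1)] K.m_assoc)
  next
    fix x assume "x \<in> carrier U"
    then obtain k where k: "k \<in> I" "x \<in> carrier (A k)" using carrier_union by auto
    interpret K: comm_group "A k" using gr k by blast
    show "\<one>\<^bsub>U\<^esub> \<otimes>\<^bsub>U\<^esub> x = x" using k by (simp add: mult_union[OF k(1)] one_union[OF k(1)])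
    show "\<exists>y\<in>carrier U. y \<otimes>\<^bsub>U\<^esub> x = \<one>\<^bsub>U\<^esub>"
      using k UI[OF k(1)]
      by (intro bexI[of _ "inv\<^bsub>A k\<^esub> x"]) (simp_all add: mult_union[OF k(1)] one_union[OF k(1)])
  qed
  moreover have "carrier U \<in> range elts"
    unfolding carrier_union small_def[symmetric]
    by (rule small_UN[OF small]) (rule ZMod_small[OF member])
  moreover have "x \<otimes>\<^bsub>U\<^esub> y = undefined" if "x \<notin> carrier U \<or> y \<notin> carrier U" for x y
    using that by (auto simp: union_structure_def)
  ultimately show ?thesis by (simp add: ZMod_def)
qed

lemma member_submodule_union: "i \<in> I \<Longrightarrow> (A i, U) \<in> submodule_rel"
  by (rule submodule_relI) (auto simp: member union_in_ZMod carrier_union mult_union)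

lemma union_submodule:
  assumes B: "B \<in> ZMod" and sub: "\<And>i. i \<in> I \<Longrightarrow> (A i, B) \<in> submodule_rel"
  shows "(U, B) \<in> submodule_rel"
proof (rule submodule_relI)
  show "x \<otimes>\<^bsub>U\<^esub> y = x \<otimes>\<^bsub>B\<^esub> y" if "x \<in> carrier U" "y \<in> carrier U" for x y
    using that by (metis common2 mult_union sub submodule_relD(5))
  show "carrier U \<subseteq> carrier B" using carrier_union sub submodule_relD(4) by blast
qed (use B union_in_ZMod in auto)

end

lemma chain_le:
  assumes \<delta>: "ordinal \<delta>" and A: "\<And>i. i \<in> elts \<delta> \<Longrightarrow> A i \<in> ZMod"
    and ch: "continuous_chain R \<delta> A" and R: "\<And>B. B \<in> ZMod \<Longrightarrow> (B, B) \<in> R"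
    and ij: "i \<in> elts \<delta>" "j \<in> elts \<delta>"
  shows "\<exists>k\<in>elts \<delta>. (A i, A k) \<in> R \<and> (A j, A k) \<in> R"
proof -
  consider "i \<in> elts j" | "i = j" | "j \<in> elts i"
    using ordinal_linear ordinal_memD[OF \<delta>] ij by blast
  then show ?thesis
    using ch R A ij unfolding continuous_chain_def by cases blast+
qed

lemma chain_directed_family:
  assumes \<delta>: "limit_ordinal \<delta>" and A: "\<And>i. i \<in> elts \<delta> \<Longrightarrow> A i \<in> ZMod"
    and ch: "continuous_chain R \<delta> A" and R: "\<And>B. B \<in> ZMod \<Longrightarrow> (B, B) \<in> R" "R \<subseteq> submodule_rel"
  shows "directed_family A (elts \<delta>)"
proof
  show "elts \<delta> \<noteq> {}" using \<delta> by (simp add: limit_ordinal_def)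
  show "\<exists>k\<in>elts \<delta>. (A i, A k) \<in> submodule_rel \<and> (A j, A k) \<in> submodule_rel"
    if "i \<in> elts \<delta>" "j \<in> elts \<delta>" for i j
    using chain_le[OF _ A ch R(1) that] \<delta> R(2) by (auto simp: limit_ordinal_def)
qed simp

section \<open>Transfinite divisibility\<close>

text \<open>
  For an ordinal \<open>w\<close> these are the elements of the Ulm subgroup $p^{w+1}G$. The recursion runs
  over membership, so that it makes sense for every set \<open>w\<close> and needs no distinction of zero,
  successors and limits. The elements of $p^w G$ are those that are divisible for all \<open>v \<in> w\<close>.
\<close>

inductive ulm_divisible :: "nat \<Rightarrow> 'a monoid \<Rightarrow> 'v::set_universe \<Rightarrow> 'a \<Rightarrow> bool"
  for p :: nat and G :: "'a monoid" where
  root: "c \<in> carrier G \<Longrightarrow> \<forall>v\<in>elts w. ulm_divisible p G v c \<Longrightarrow> ulm_divisible p G w (c [^]\<^bsub>G\<^esub> p)"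

lemma ulm_divisibleE:
  assumes "ulm_divisible p G w b"
  obtains c where "c \<in> carrier G" "c [^]\<^bsub>G\<^esub> p = b" "\<forall>v\<in>elts w. ulm_divisible p G v c"
  using assms by cases blast

lemma ulm_divisible_hom:
  assumes "h \<in> hom G H" "group G" "group H" "ulm_divisible p G w b"
  shows "ulm_divisible p H w (h b)"
  using assms(4)
proof induction
  case (root c w)
  have "h (c [^]\<^bsub>G\<^esub> p) = h c [^]\<^bsub>H\<^esub> p" using hom_nat_pow root assms by metis
  then show ?case using root assms(1) by (auto intro: ulm_divisible.root hom_in_carrier)
qed

lemma ulm_divisible_submodule:
  assumes "(A, B) \<in> submodule_rel" "ulm_divisible p A w a" shows "ulm_divisible p B w a"
  by (rule ulm_divisible_hom[OF submodule_rel_hom[OF assms(1)] _ _ assms(2)])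
    (use submodule_relD(1,2)[OF assms(1)] ZMod_group in auto)

text \<open>
  Isotype embeddings, relative to a class of indices: the subgroup carries the filtration by the
  chosen Ulm subgroups that the large group induces on it. One direction is automatic, since
  homomorphisms preserve divisibility.
\<close>

definition isotype_rel :: "(nat \<times> 'v::set_universe) set \<Rightarrow> 'v monoid rel" where
  "isotype_rel I = {(A, B). (A, B) \<in> submodule_rel \<and>
     (\<forall>p w a. (p, w) \<in> I \<longrightarrow> a \<in> carrier A \<longrightarrow> ulm_divisible p B w a \<longrightarrow> ulm_divisible p A w a)}"

lemma isotype_relI:
  assumes "(A, B) \<in> submodule_rel"
    "\<And>p w a. (p, w) \<in> I \<Longrightarrow> a \<in> carrier A \<Longrightarrow> ulm_divisible p B w a \<Longrightarrow> ulm_divisible p A w a"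
  shows "(A, B) \<in> isotype_rel I"
  using assms by (simp add: isotype_rel_def)

lemma isotype_relD:
  assumes "(A, B) \<in> isotype_rel I"
  shows "(A, B) \<in> submodule_rel"
    "(p, w) \<in> I \<Longrightarrow> a \<in> carrier A \<Longrightarrow> ulm_divisible p B w a \<Longrightarrow> ulm_divisible p A w a"
  using assms by (auto simp: isotype_rel_def)

lemma isotype_rel_refl: "A \<in> ZMod \<Longrightarrow> (A, A) \<in> isotype_rel I"
  by (simp add: isotype_rel_def submodule_rel_refl)

lemma isotype_rel_trans:
  assumes "(A, B) \<in> isotype_rel I" "(B, C) \<in> isotype_rel I" shows "(A, C) \<in> isotype_rel I"
proof (rule isotype_relI)
  show "(A, C) \<in> submodule_rel"
    by (rule submodule_rel_trans[OF assms[THEN isotype_relD(1)]])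
  show "ulm_divisible p A w a" if "(p, w) \<in> I" "a \<in> carrier A" "ulm_divisible p C w a" for p w a
    using isotype_relD(2)[OF assms(1)] isotype_relD(2)[OF assms(2)] that
      submodule_relD(4)[OF isotype_relD(1)[OF assms(1)]] by blast
qed

lemma isotype_rel_coherent:
  assumes "(A, C) \<in> isotype_rel I" "(B, C) \<in> submodule_rel" "(A, B) \<in> submodule_rel"
  shows "(A, B) \<in> isotype_rel I"
proof (rule isotype_relI)
  fix p w a assume "(p, w) \<in> I" "a \<in> carrier A" "ulm_divisible p B w a"
  then show "ulm_divisible p A w a"
    using isotype_relD(2)[OF assms(1)] ulm_divisible_submodule[OF assms(2)] by blast
qed (rule assms)

lemma isotype_rel_iso:
  assumes AB: "(A, B) \<in> isotype_rel I" and A': "A' \<in> ZMod" and B': "B' \<in> ZMod"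
    and hB: "h \<in> iso B B'" and hA: "h \<in> iso A A'"
  shows "(A', B') \<in> isotype_rel I"
proof (rule isotype_relI)
  have sub: "(A, B) \<in> submodule_rel" using AB isotype_relD by blast
  note D = submodule_relD[OF sub]
  have gr: "group A" "group B" "group A'" "group B'" using D A' B' ZMod_group by blast+
  have im: "carrier A' = h ` carrier A" "carrier B' = h ` carrier B"
    using hA hB by (auto simp: iso_def bij_betw_def)
  have homs: "h \<in> hom A A'" "h \<in> hom B B'" using hA hB by (auto simp: iso_def)
  show "(A', B') \<in> submodule_rel"
  proof (rule submodule_relI)
    fix x y assume "x \<in> carrier A'" "y \<in> carrier A'"
    then obtain a b where ab: "a \<in> carrier A" "b \<in> carrier A" "x = h a" "y = h b"
      unfolding im by (elim imageE)
    then have "x \<otimes>\<^bsub>A'\<^esub> y = h (a \<otimes>\<^bsub>A\<^esub> b)" using homs by (simp add: hom_mult)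
    also have "\<dots> = h (a \<otimes>\<^bsub>B\<^esub> b)" using D(5) ab by simp
    also have "\<dots> = x \<otimes>\<^bsub>B'\<^esub> y" using homs ab D(4) by (auto simp: hom_mult subset_iff)
    finally show "x \<otimes>\<^bsub>A'\<^esub> y = x \<otimes>\<^bsub>B'\<^esub> y" .
  qed (use A' B' im D in auto)
  fix p w a' assume I: "(p, w) \<in> I" and a': "a' \<in> carrier A'" and div: "ulm_divisible p B' w a'"
  obtain a where a: "a \<in> carrier A" "a' = h a" using a' unfolding im by (elim imageE)
  have g: "inv_into (carrier B) h \<in> hom B' B"
    using group.iso_set_sym[OF gr(2) hB] by (simp add: iso_def)
  have "inv_into (carrier B) h a' = a"
    using a D(4) hB by (auto simp: iso_def bij_betw_def intro!: inv_into_f_f)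
  then have "ulm_divisible p B w a" using ulm_divisible_hom[OF g gr(4,2) div] by simp
  then have "ulm_divisible p A w a" using isotype_relD(2)[OF AB I] a by blast
  then show "ulm_divisible p A' w a'" using ulm_divisible_hom[OF homs(1) gr(1,3)] a by simp
qed

text \<open>
  The projection onto a summand is a homomorphism that fixes the summand, and homomorphisms
  preserve divisibility.
\<close>

lemma summand_subset_isotype_rel: "summand_rel \<subseteq> isotype_rel I"
proof (rule subrelI, rule isotype_relI)
  fix A B :: "'a monoid" assume AB: "(A, B) \<in> summand_rel"
  then show sub: "(A, B) \<in> submodule_rel" by (simp add: summand_rel_def)
  obtain \<pi> where \<pi>: "\<pi> \<in> hom B A" "\<And>a. a \<in> carrier A \<Longrightarrow> \<pi> a = a"
    using summand_rel_projection[OF AB] by blast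
  fix p and w :: 'a and a assume "a \<in> carrier A" "ulm_divisible p B w a"
  then show "ulm_divisible p A w a"
    using ulm_divisible_hom[OF \<pi>(1), of p w a] \<pi>(2) submodule_relD[OF sub] ZMod_group by metis
qed

definition hereditary :: "(nat \<times> 'v::set_universe) set \<Rightarrow> bool" where
  "hereditary I \<longleftrightarrow> (\<forall>p w v. (p, w) \<in> I \<longrightarrow> v \<in> elts w \<longrightarrow> (p, v) \<in> I)"

text \<open>
  A witness of divisibility in the union lies in some member of the chain; choosing the member large
  enough to contain the given \<open>A i\<close> as well, isotypeness brings the divisibility back
  down to \<open>A i\<close>. As the witness itself has to be divisible along smaller indices, the index set
  must be hereditary for the induction to go through.
\<close>

lemma ulm_divisible_union:
  assumes I: "hereditary I" and U: "directed_family A D"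
    and R: "\<And>i j. i \<in> D \<Longrightarrow> j \<in> D \<Longrightarrow> \<exists>k\<in>D. (A i, A k) \<in> isotype_rel I \<and> (A j, A k) \<in> isotype_rel I"
    and b: "ulm_divisible p (union_structure A D) w b"
  shows "(p, w) \<in> I \<Longrightarrow> i \<in> D \<Longrightarrow> b \<in> carrier (A i) \<Longrightarrow> ulm_divisible p (A i) w b"
  using b
proof (induction arbitrary: i)
  case (root c w)
  interpret directed_family A D by fact
  obtain j where j: "j \<in> D" "c \<in> carrier (A j)" using root(1) carrier_union by auto
  then obtain k where k: "k \<in> D" "(A i, A k) \<in> isotype_rel I" "(A j, A k) \<in> isotype_rel I"
    using R[OF \<open>i \<in> D\<close> j(1)] by blast
  then have ck: "c \<in> carrier (A k)" using j submodule_relD(4) isotype_relD(1) by blast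
  have "\<forall>v\<in>elts w. ulm_divisible p (A k) v c"
    using root ck k(1) I unfolding hereditary_def by blast
  then have "ulm_divisible p (A k) w (c [^]\<^bsub>A k\<^esub> p)" using ck by (intro ulm_divisible.root)
  then have "ulm_divisible p (A k) w (c [^]\<^bsub>U\<^esub> p)"
    using submodule_rel_nat_pow[OF member_submodule_union[OF k(1)] ck] by simp
  then show ?case using isotype_relD(2)[OF k(2)] root by blast
qed

section \<open>Isotype embeddings form abstract elementary classes\<close>

definition group_ops :: "'a monoid \<Rightarrow> ('a list \<Rightarrow> 'a) set" where
  "group_ops G = {\<lambda>_. \<one>\<^bsub>G\<^esub>, \<lambda>xs. case xs of [x] \<Rightarrow> inv\<^bsub>G\<^esub> x | [x, y] \<Rightarrow> x \<otimes>\<^bsub>G\<^esub> y | _ \<Rightarrow> \<one>\<^bsub>G\<^esub>}"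

lemma group_ops_closed:
  assumes "group G" "f \<in> group_ops G" "set xs \<subseteq> carrier G"
  shows "f xs \<in> carrier G"
proof -
  interpret group G by fact
  show ?thesis using assms(2,3) by (auto simp: group_ops_def split: list.splits)
qed

lemma subgroup_fun_closure:
  assumes "group G" and F: "group_ops G \<subseteq> F" and sub: "fun_closure F X \<subseteq> carrier G"
  shows "subgroup (fun_closure F X) G"
proof -
  interpret group G by fact
  let ?op = "\<lambda>xs. case xs of [x] \<Rightarrow> inv\<^bsub>G\<^esub> x | [x, y] \<Rightarrow> x \<otimes>\<^bsub>G\<^esub> y | _ \<Rightarrow> \<one>\<^bsub>G\<^esub>"
  have ops: "(\<lambda>_. \<one>\<^bsub>G\<^esub>) \<in> F" "?op \<in> F" using F by (auto simp: group_ops_def)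
  show ?thesis
  proof (rule subgroupI)
    show "fun_closure F X \<noteq> {}" using fun_closure.step[OF ops(1), of "[]"] by auto
    show "inv\<^bsub>G\<^esub> a \<in> fun_closure F X" if "a \<in> fun_closure F X" for a
      using fun_closure.step[OF ops(2), of "[a]"] that by simp
    show "a \<otimes>\<^bsub>G\<^esub> b \<in> fun_closure F X" if "a \<in> fun_closure F X" "b \<in> fun_closure F X" for a b
      using fun_closure.step[OF ops(2), of "[a, b]"] that by simp
  qed (rule sub)
qed

text \<open>
  Close \<open>X\<close> under the group operations and, for each index \<open>(p, w)\<close>, under a function choosing a
  \<open>p\<close>-th root that witnesses divisibility along \<open>w\<close>. By induction on \<open>w\<close> the chosen
  roots are as divisible in the closure as they are in \<open>B\<close>.
\<close>

lemma isotype_rel_LS: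
  fixes I :: "(nat \<times> 'v::set_universe) set" and l :: 'v
  assumes I: "hereditary I" and l: "infinite (elts l)" "|I| \<le>o |elts l|"
    and B: "B \<in> ZMod" and X: "X \<subseteq> carrier B"
  shows "\<exists>A\<in>ZMod. X \<subseteq> carrier A \<and> (A, B) \<in> isotype_rel I \<and> |carrier A| \<le>o |X| +c |elts l|"
proof -
  interpret B: group B using B by (rule ZMod_group)
  define g where "g = (\<lambda>(p, w :: 'v) xs. if ulm_divisible p B w (hd xs)
    then SOME c. c \<in> carrier B \<and> c [^]\<^bsub>B\<^esub> p = hd xs \<and> (\<forall>v\<in>elts w. ulm_divisible p B v c)
    else \<one>\<^bsub>B\<^esub>)"
  have g: "g (p, w) [b] \<in> carrier B \<and> g (p, w) [b] [^]\<^bsub>B\<^esub> p = b \<and> (\<forall>v\<in>elts w. ulm_divisible p B v (g (p, w) [b]))"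
    if "ulm_divisible p B w b" for p w b
  proof -
    have "\<exists>c. c \<in> carrier B \<and> c [^]\<^bsub>B\<^esub> p = b \<and> (\<forall>v\<in>elts w. ulm_divisible p B v c)"
      using ulm_divisibleE[OF that] by metis
    from someI_ex[OF this] show ?thesis using that by (simp add: g_def)
  qed
  have g_closed: "g i xs \<in> carrier B" for i xs
    using g[of "fst i" "snd i" "hd xs"] B.one_closed
    by (cases "ulm_divisible (fst i) B (snd i) (hd xs)") (auto simp: g_def split_beta)
  define F where "F = group_ops B \<union> g ` I"
  define C where "C = fun_closure F X"
  have CB: "C \<subseteq> carrier B" unfolding C_def
    by (rule fun_closure_subset[OF X]) (use group_ops_closed[OF B.is_group] g_closed in \<open>auto simp: F_def\<close>)
  have C: "subgroup C B" unfolding C_def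
    by (rule subgroup_fun_closure) (use CB in \<open>auto simp: F_def C_def\<close>)
  define A where "A = induced B C"
  have AB: "(A, B) \<in> submodule_rel" unfolding A_def by (rule induced_submodule_rel[OF B C])
  have cA: "carrier A = C" by (simp add: A_def)
  have "ulm_divisible p A w a" if "ulm_divisible p B w a" "(p, w) \<in> I" "a \<in> C" for p w a
    using that
  proof (induction w arbitrary: a rule: wf_induct_rule[OF foundation])
    case (1 w)
    let ?c = "g (p, w) [a]"
    have c: "?c \<in> C" unfolding C_def
      by (rule fun_closure.step) (use 1 in \<open>auto simp: F_def C_def\<close>)
    have "\<forall>v\<in>elts w. ulm_divisible p A v ?c"
      using 1 c g[OF 1(2)] I unfolding hereditary_def by blast
    then have "ulm_divisible p A w (?c [^]\<^bsub>A\<^esub> p)" using c cA by (intro ulm_divisible.root) auto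
    then show ?case using submodule_rel_nat_pow[OF AB] c cA g[OF 1(2)] by simp
  qed
  then have "(A, B) \<in> isotype_rel I" using AB cA by (intro isotype_relI) auto
  moreover have "X \<subseteq> carrier A" unfolding cA C_def by (auto intro: fun_closure.base)
  moreover have "|carrier A| \<le>o |X| +c |elts l|"
  proof -
    let ?K = "X <+> elts l"
    have K: "infinite ?K" using l by simp
    have lK: "|elts l| \<le>o |?K|" by (rule card_of_Plus2)
    have "|g ` I| \<le>o |?K|" by (rule ordLeq_transitive[OF card_of_image ordLeq_transitive[OF l(2) lK]])
    moreover have "|group_ops B| \<le>o |?K|"
      by (rule finite_card_le_infinite[OF _ K]) (simp add: group_ops_def)
    ultimately have "|F| \<le>o |?K|" unfolding F_def using K
      by (intro card_of_Un_ordLeq_infinite_Field) (simp_all only: Field_card_of card_of_card_order_on not_False_eq_True)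
    then have "|C| \<le>o |?K|" unfolding C_def
      by (rule fun_closure_card_le[OF K card_of_Plus1])
    moreover have "|?K| =o |X| +c |elts l|" by (rule Plus_csum)
    ultimately show ?thesis using cA ordLeq_ordIso_trans by metis
  qed
  moreover have "A \<in> ZMod" using AB submodule_relD by blast
  ultimately show ?thesis by blast
qed

theorem isotype_rel_in_LZ:
  fixes I :: "(nat \<times> 'v::set_universe) set" and l :: 'v
  assumes I: "hereditary I" and l: "infinite (elts l)" "|I| \<le>o |elts l|"
  shows "isotype_rel I \<in> LZ"
proof -
  have sub: "isotype_rel I \<subseteq> submodule_rel" using isotype_relD(1) by auto
  have subZ: "isotype_rel I \<subseteq> ZMod \<times> ZMod"
  proof (rule subrelI)
    fix A B assume "(A, B) \<in> isotype_rel I"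
    then have "(A, B) \<in> submodule_rel" by (rule isotype_relD(1))
    then show "(A, B) \<in> ZMod \<times> ZMod" using submodule_relD(1,2) by blast
  qed
  have chain: "union_structure A (elts \<delta>) \<in> ZMod"
      "j \<in> elts \<delta> \<Longrightarrow> (A j, union_structure A (elts \<delta>)) \<in> isotype_rel I"
      "B \<in> ZMod \<Longrightarrow> (\<And>i. i \<in> elts \<delta> \<Longrightarrow> (A i, B) \<in> isotype_rel I) \<Longrightarrow>
        (union_structure A (elts \<delta>), B) \<in> isotype_rel I"
    if \<delta>: "limit_ordinal \<delta>" and A: "\<And>i. i \<in> elts \<delta> \<Longrightarrow> A i \<in> ZMod"
      and ch: "continuous_chain (isotype_rel I) \<delta> A" for \<delta> A j B
  proof -
    interpret directed_family A "elts \<delta>"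
      using chain_directed_family[OF \<delta> A ch isotype_rel_refl sub] by blast
    have R: "\<exists>k\<in>elts \<delta>. (A i, A k) \<in> isotype_rel I \<and> (A j, A k) \<in> isotype_rel I"
      if "i \<in> elts \<delta>" "j \<in> elts \<delta>" for i j
      using chain_le[OF _ A ch isotype_rel_refl that] \<delta> by (auto simp: limit_ordinal_def)
    show "U \<in> ZMod" by (rule union_in_ZMod)
    show "(A j, U) \<in> isotype_rel I" if "j \<in> elts \<delta>" for j
      using that ulm_divisible_union[OF I directed_family_axioms R] member_submodule_union
      by (intro isotype_relI) auto
    assume B: "B \<in> ZMod" and AB: "\<And>i. i \<in> elts \<delta> \<Longrightarrow> (A i, B) \<in> isotype_rel I"
    show "(U, B) \<in> isotype_rel I"
    proof (rule isotype_relI)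
      show "(U, B) \<in> submodule_rel" using union_submodule[OF B] AB isotype_relD(1) by blast
      fix p w a assume "(p, w) \<in> I" "a \<in> carrier U" "ulm_divisible p B w a"
      then show "ulm_divisible p U w a"
        using AB carrier_union isotype_relD(2) ulm_divisible_submodule[OF member_submodule_union]
        by (metis UN_E)
    qed
  qed
  have po: "partial_order_on ZMod (isotype_rel I)"
    unfolding partial_order_on_def preorder_on_def
  proof (intro conjI)
    show "refl_on ZMod (isotype_rel I)" by (rule refl_onI) (rule isotype_rel_refl)
    show "isotype_rel I \<subseteq> ZMod \<times> ZMod" by (rule subZ)
    show "trans (isotype_rel I)" by (rule transI) (rule isotype_rel_trans)
    show "antisym (isotype_rel I)" by (rule antisymI) (metis isotype_relD(1) submodule_rel_antisym)
  qed
  have "aec ZMod (isotype_rel I)"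
    unfolding aec_def
  proof (intro conjI allI impI ballI)
    show "isotype_rel I \<subseteq> ZMod \<times> ZMod" by (rule subZ)
    show "isotype_rel I \<subseteq> submodule_rel" by (rule sub)
    show "partial_order_on ZMod (isotype_rel I)" by (rule po)
    show "\<exists>l::'v. infinite (elts l) \<and> (\<forall>B\<in>ZMod. \<forall>X\<subseteq>carrier B. \<exists>A\<in>ZMod.
           X \<subseteq> carrier A \<and> (A, B) \<in> isotype_rel I \<and> |carrier A| \<le>o |X| +c |elts l| )"
      using isotype_rel_LS[OF I l] l(1) by blast
  next
    fix A B A' B' :: "'v monoid" and h
    assume "(A, B) \<in> isotype_rel I" "A' \<in> ZMod" "B' \<in> ZMod" "h \<in> iso B B'" "h \<in> iso A A'"
    then show "(A', B') \<in> isotype_rel I" by (rule isotype_rel_iso)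
  next
    fix A B C :: "'v monoid"
    assume "(A, C) \<in> isotype_rel I" "(B, C) \<in> isotype_rel I" "(A, B) \<in> submodule_rel"
    then show "(A, B) \<in> isotype_rel I" using isotype_rel_coherent isotype_relD(1) by metis
  next
    fix \<delta> :: 'v and A :: "'v \<Rightarrow> 'v monoid"
    assume *: "limit_ordinal \<delta>" "\<forall>i\<in>elts \<delta>. A i \<in> ZMod" "continuous_chain (isotype_rel I) \<delta> A"
    show "union_structure A (elts \<delta>) \<in> ZMod" using chain(1) * by simp
    show "(A j, union_structure A (elts \<delta>)) \<in> isotype_rel I" if "j \<in> elts \<delta>" for j
      using chain(2) * that by simp
    show "(union_structure A (elts \<delta>), B) \<in> isotype_rel I"
      if "B \<in> ZMod" "\<forall>i\<in>elts \<delta>. (A i, B) \<in> isotype_rel I" for B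
      using chain(3) * that by simp
  qed auto
  then show ?thesis using summand_subset_isotype_rel by (simp add: LZ_def)
qed

section \<open>Pure hulls\<close>

definition system_solution :: "'a monoid \<Rightarrow> int list list \<Rightarrow> nat \<Rightarrow> 'a list \<Rightarrow> nat \<Rightarrow> 'a" where
  "system_solution G rs n as =
     (SOME x. solves G (length rs) n (\<lambda>i j. rs ! i ! j) (\<lambda>i. as ! i) x)"

text \<open>
  Skolem functions for purity. A coefficient matrix is given by the list of its rows; thus there are
  only countably many operations, although a system is given by a total function on pairs of numbers.
  The default value keeps the operation inside the group if there is no solution.
\<close>

definition solution_op :: "'a monoid \<Rightarrow> int list list \<times> nat \<times> nat \<Rightarrow> 'a list \<Rightarrow> 'a" where
  "solution_op G = (\<lambda>(rs, n, j) as.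
     if j < n \<and> (\<exists>x. solves G (length rs) n (\<lambda>i j. rs ! i ! j) (\<lambda>i. as ! i) x)
     then system_solution G rs n as j else \<one>\<^bsub>G\<^esub>)"

definition pure_ops :: "'a monoid \<Rightarrow> ('a list \<Rightarrow> 'a) set" where
  "pure_ops G = group_ops G \<union> range (solution_op G)"

lemma system_solution:
  assumes "solves G (length rs) n (\<lambda>i j. rs ! i ! j) (\<lambda>i. as ! i) x"
  shows "solves G (length rs) n (\<lambda>i j. rs ! i ! j) (\<lambda>i. as ! i) (system_solution G rs n as)"
  unfolding system_solution_def using assms
  by (rule someI[of "solves G (length rs) n (\<lambda>i j. rs ! i ! j) (\<lambda>i. as ! i)"])

lemma solution_op_closed:
  assumes "group G" shows "solution_op G i as \<in> carrier G"
proof -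
  obtain rs n j where i: "i = (rs, n, j)" by (cases i)
  show ?thesis
  proof (cases "j < n \<and> (\<exists>x. solves G (length rs) n (\<lambda>i j. rs ! i ! j) (\<lambda>i. as ! i) x)")
    case True
    then obtain x where "solves G (length rs) n (\<lambda>i j. rs ! i ! j) (\<lambda>i. as ! i) x" by blast
    from system_solution[OF this] show ?thesis using True i
      by (simp add: solution_op_def) (simp add: solves_def)
  next
    case False
    then show ?thesis using i group.is_monoid[OF assms] by (auto simp: solution_op_def)
  qed
qed

lemma countable_pure_ops: "countable (pure_ops G)"
  by (simp add: pure_ops_def group_ops_def)

definition pure_hull :: "'a monoid \<Rightarrow> 'a set \<Rightarrow> 'a monoid" where
  "pure_hull G X = induced G (fun_closure (pure_ops G) X)"

lemma carrier_pure_hull: "carrier (pure_hull G X) = fun_closure (pure_ops G) X"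
  by (simp add: pure_hull_def)

lemma subset_pure_hull: "X \<subseteq> carrier (pure_hull G X)"
  unfolding carrier_pure_hull by (auto intro: fun_closure.base)

lemma pure_hull_pure:
  assumes G: "G \<in> ZMod" and X: "X \<subseteq> carrier G"
  shows "(pure_hull G X, G) \<in> pure_rel"
proof -
  interpret G: comm_group G using G by (rule ZMod_comm_group)
  let ?C = "fun_closure (pure_ops G) X"
  have CG: "?C \<subseteq> carrier G"
    by (rule fun_closure_subset[OF X])
      (use group_ops_closed[OF G.is_group] solution_op_closed[OF G.is_group] in \<open>auto simp: pure_ops_def\<close>)
  then have "subgroup ?C G"
    by (intro subgroup_fun_closure) (auto simp: pure_ops_def)
  then have sub: "(pure_hull G X, G) \<in> submodule_rel"
    unfolding pure_hull_def by (rule induced_submodule_rel[OF G])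
  have "\<exists>y. solves (pure_hull G X) m n r a y" if a: "\<forall>i<m. a i \<in> ?C" and x: "solves G m n r a x" for m n r a x
  proof -
    define rs where "rs = map (\<lambda>i. map (r i) [0..<n]) [0..<m]"
    define as where "as = map a [0..<m]"
    have "solves G (length rs) n (\<lambda>i j. rs ! i ! j) (\<lambda>i. as ! i) x"
      using solves_cong[OF G.comm_group_axioms x, of "\<lambda>i j. rs ! i ! j" "\<lambda>i. as ! i"]
      by (simp add: rs_def as_def)
    note y = system_solution[OF this]
    let ?y = "system_solution G rs n as"
    have "?y j \<in> ?C" if "j < n" for j
    proof -
      have "solution_op G (rs, n, j) as \<in> ?C"
        by (rule fun_closure.step) (use a in \<open>auto simp: pure_ops_def as_def\<close>)
      moreover have "solution_op G (rs, n, j) as = ?y j"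
        using that y unfolding solution_op_def by (simp only: prod.case) (metis (no_types))
      ultimately show ?thesis by simp
    qed
    moreover have "solves G m n r a ?y"
      using solves_cong[OF G.comm_group_axioms y, of r a] by (simp add: rs_def as_def)
    ultimately have "solves (pure_hull G X) m n r a ?y"
      using solves_submodule[OF sub] carrier_pure_hull by metis
    then show ?thesis by blast
  qed
  note solvable = this
  show ?thesis
    unfolding pure_rel_def mem_Collect_eq prod.case carrier_pure_hull
  proof (intro conjI allI impI)
    fix m n r a assume "\<forall>i<m. a i \<in> ?C" and "\<exists>x. solves G m n r a x"
    then show "\<exists>x. solves (pure_hull G X) m n r a x" using solvable by (elim exE)
  qed (rule sub)
qed

lemma countable_iff_card_le_nat: "countable A \<longleftrightarrow> |A| \<le>o |UNIV :: nat set|"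
  by (auto simp: countable_def card_of_ordLeq[symmetric])

lemma countable_pure_hull: "countable X \<Longrightarrow> countable (carrier (pure_hull G X))"
  using fun_closure_card_le[of "UNIV :: nat set" X "pure_ops G"] countable_pure_ops[of G]
  by (simp add: carrier_pure_hull countable_iff_card_le_nat)

lemma pure_rel_submodule: "pure_rel \<subseteq> submodule_rel"
  by (auto simp: pure_rel_def)

lemma pure_hull_mono:
  assumes "G \<in> ZMod" "X \<subseteq> Y" "Y \<subseteq> carrier G"
  shows "(pure_hull G X, pure_hull G Y) \<in> submodule_rel"
proof (rule submodule_rel_within)
  show "(pure_hull G X, G) \<in> submodule_rel" "(pure_hull G Y, G) \<in> submodule_rel"
    using pure_hull_pure[of G] pure_rel_submodule assms by auto
  show "carrier (pure_hull G X) \<subseteq> carrier (pure_hull G Y)"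
    unfolding carrier_pure_hull by (rule fun_closure_mono[OF assms(2)])
qed

text \<open>
  Since the operations are finitary, forming the hull commutes with directed unions. This makes
  hulls of an increasing sequence of sets a continuous chain.
\<close>

lemma union_pure_hull:
  fixes I :: "'v::set_universe set" and X :: "'v \<Rightarrow> 'v set"
  assumes G: "G \<in> ZMod" and I: "small I" "I \<noteq> {}" and X: "\<And>i. i \<in> I \<Longrightarrow> X i \<subseteq> carrier G"
    and dir: "\<And>i j. i \<in> I \<Longrightarrow> j \<in> I \<Longrightarrow> \<exists>k\<in>I. X i \<subseteq> X k \<and> X j \<subseteq> X k"
  shows "union_structure (\<lambda>i. pure_hull G (X i)) I = pure_hull G (\<Union>i\<in>I. X i)"
proof -
  interpret directed_family "\<lambda>i. pure_hull G (X i)" I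
  proof
    fix i j assume "i \<in> I" "j \<in> I"
    then obtain k where "k \<in> I" "X i \<subseteq> X k" "X j \<subseteq> X k" using dir by blast
    then show "\<exists>k\<in>I. (pure_hull G (X i), pure_hull G (X k)) \<in> submodule_rel \<and>
        (pure_hull G (X j), pure_hull G (X k)) \<in> submodule_rel"
      using pure_hull_mono[OF G] X by (intro bexI[of _ k]) auto
  qed (use I in auto)
  have "(pure_hull G (X i), G) \<in> submodule_rel" if "i \<in> I" for i
    using pure_hull_pure[OF G X[OF that]] pure_rel_submodule by blast
  then have "(U, G) \<in> submodule_rel" by (rule union_submodule[OF G])
  then have "U = induced G (carrier U)" by (rule submodule_rel_induced)
  moreover have "carrier U = fun_closure (pure_ops G) (\<Union>i\<in>I. X i)"
    unfolding carrier_union carrier_pure_hull using fun_closure_UN[OF I(2) dir] by simp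
  ultimately show ?thesis by (simp add: pure_hull_def)
qed

section \<open>Relations containing purity are determined by countable groups\<close>

lemma LZ_D:
  assumes "R \<in> LZ"
  shows "R \<subseteq> submodule_rel"
    and "(A, B) \<in> R \<Longrightarrow> (B, C) \<in> R \<Longrightarrow> (A, C) \<in> R"
    and "(A, C) \<in> R \<Longrightarrow> (B, C) \<in> R \<Longrightarrow> (A, B) \<in> submodule_rel \<Longrightarrow> (A, B) \<in> R"
    and "(A, B) \<in> R \<Longrightarrow> A' \<in> ZMod \<Longrightarrow> B' \<in> ZMod \<Longrightarrow> h \<in> iso B B' \<Longrightarrow> h \<in> iso A A' \<Longrightarrow> (A', B') \<in> R"
    and "limit_ordinal \<delta> \<Longrightarrow> \<forall>i\<in>elts \<delta>. F i \<in> ZMod \<Longrightarrow> continuous_chain R \<delta> F \<Longrightarrow>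
      B \<in> ZMod \<Longrightarrow> \<forall>i\<in>elts \<delta>. (F i, B) \<in> R \<Longrightarrow> (union_structure F (elts \<delta>), B) \<in> R"
proof -
  have aec: "aec ZMod R" using assms by (simp add: LZ_def)
  show "R \<subseteq> submodule_rel" using aec unfolding aec_def by (elim conjE) assumption
  have "partial_order_on ZMod R" using aec unfolding aec_def by (elim conjE) assumption
  then show "(A, B) \<in> R \<Longrightarrow> (B, C) \<in> R \<Longrightarrow> (A, C) \<in> R"
    unfolding partial_order_on_def preorder_on_def by (auto dest: transD)
  have "\<forall>A B C. (A, C) \<in> R \<longrightarrow> (B, C) \<in> R \<longrightarrow> (A, B) \<in> submodule_rel \<longrightarrow> (A, B) \<in> R"
    using aec unfolding aec_def by (elim conjE) assumption
  then show "(A, C) \<in> R \<Longrightarrow> (B, C) \<in> R \<Longrightarrow> (A, B) \<in> submodule_rel \<Longrightarrow> (A, B) \<in> R"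
    by (elim allE impE)
  have "\<forall>A B A' B' h. (A, B) \<in> R \<longrightarrow> A' \<in> ZMod \<longrightarrow> B' \<in> ZMod \<longrightarrow>
      h \<in> iso B B' \<longrightarrow> h \<in> iso A A' \<longrightarrow> (A', B') \<in> R"
    using aec unfolding aec_def by (elim conjE) assumption
  then show "(A, B) \<in> R \<Longrightarrow> A' \<in> ZMod \<Longrightarrow> B' \<in> ZMod \<Longrightarrow> h \<in> iso B B' \<Longrightarrow> h \<in> iso A A' \<Longrightarrow> (A', B') \<in> R"
    by (elim allE impE)
  have "\<forall>\<delta> A. limit_ordinal \<delta> \<longrightarrow> (\<forall>i\<in>elts \<delta>. A i \<in> ZMod) \<longrightarrow> continuous_chain R \<delta> A \<longrightarrow>
        union_structure A (elts \<delta>) \<in> ZMod \<and>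
        (\<forall>j\<in>elts \<delta>. (A j, union_structure A (elts \<delta>)) \<in> R) \<and>
        (\<forall>B\<in>ZMod. (\<forall>i\<in>elts \<delta>. (A i, B) \<in> R) \<longrightarrow> (union_structure A (elts \<delta>), B) \<in> R)"
    using aec unfolding aec_def by (elim conjE) assumption
  from this[THEN spec[of _ \<delta>], THEN spec[of _ F]]
  show "limit_ordinal \<delta> \<Longrightarrow> \<forall>i\<in>elts \<delta>. F i \<in> ZMod \<Longrightarrow> continuous_chain R \<delta> F \<Longrightarrow>
      B \<in> ZMod \<Longrightarrow> \<forall>i\<in>elts \<delta>. (F i, B) \<in> R \<Longrightarrow> (union_structure F (elts \<delta>), B) \<in> R"
    by simp
qed

text \<open>
  Induction on the cardinality of \<open>X\<close>. An uncountable \<open>X\<close> is enumerated along its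
  cardinal; the hulls of the proper initial segments form a continuous chain of pure subgroups of \<open>A\<close>,
  hence an \<open>S\<close>-chain, whose members are in relation \<open>S\<close> to \<open>B\<close> because the segments are
  smaller than \<open>X\<close>. The union axiom passes this on to the hull of \<open>X\<close>.
\<close>

lemma pure_hull_rel:
  assumes S: "S \<in> LZ1" and A: "A \<in> ZMod" and B: "B \<in> ZMod"
    and countable: "\<And>X. countable X \<Longrightarrow> X \<subseteq> carrier A \<Longrightarrow> (pure_hull A X, B) \<in> S"
    and X: "X \<subseteq> carrier A"
  shows "(pure_hull A X, B) \<in> S"
proof -
  have SL: "S \<in> LZ" and pureS: "pure_rel \<subseteq> S" using S by (auto simp: LZ1_def)
  have "wf (inv_image ordLess (card_of :: 'a set \<Rightarrow> 'a rel))" by (intro wf_inv_image wf_ordLess)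
  then show ?thesis using X
  proof (induction X rule: wf_induct_rule)
    case (less X)
    show ?case
    proof (cases "countable X")
      case True
      then show ?thesis using countable less by blast
    next
      case False
      then have inf: "infinite X" using countable_finite by blast
      define r where "r = |X|"
      have Fr: "Field r = X" and Cr: "Card_order r"
        unfolding r_def by (rule Field_card_of, rule card_of_Card_order)
      have smX: "small X" using small_subset[OF ZMod_small[OF A] less.prems] .
      \<comment> \<open>The axioms quantify over chains along ordinals of the universe, so the well-order of \<open>X\<close>
        is collapsed to such an ordinal.\<close>
      obtain \<delta> :: 'a and f where \<delta>: "ordinal \<delta>" "bij_betw f X (elts \<delta>)"
        and f: "\<And>a. a \<in> X \<Longrightarrow> elts (f a) = f ` underS r a"
        using mostowski_collapse[OF card_of_well_order_on[of X] smX] unfolding r_def by metis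
      have underX: "underS r a \<subseteq> X" for a using Fr by (auto simp: underS_def Field_def)
      have lim: "limit_ordinal \<delta>" unfolding limit_ordinal_def
      proof (intro conjI ballI)
        show "elts \<delta> \<noteq> {}" using inf \<delta>(2) by (auto simp: bij_betw_def)
        fix \<alpha> assume "\<alpha> \<in> elts \<delta>"
        then obtain a where a: "a \<in> X" "\<alpha> = f a" using \<delta>(2) by (auto simp: bij_betw_def)
        then obtain b where "b \<in> X" "a \<noteq> b" "(a, b) \<in> r"
          using infinite_Card_order_limit[OF Cr] inf Fr by metis
        then show "\<exists>\<beta>\<in>elts \<delta>. \<alpha> \<in> elts \<beta>"
          using f[of b] a \<delta>(2) by (intro bexI[of _ "f b"]) (auto simp: underS_def bij_betw_def)
      qed (rule \<delta>(1))
      define Y where "Y i = {x \<in> X. f x \<in> elts i}" for i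
      have YX: "Y i \<subseteq> X" for i by (auto simp: Y_def)
      have YA: "Y i \<subseteq> carrier A" for i using YX less.prems by blast
      have Y_less: "|Y i| <o |X|" if i: "i \<in> elts \<delta>" for i
      proof -
        obtain a where a: "a \<in> X" "i = f a" using i \<delta>(2) unfolding bij_betw_def by blast
        have "Y i = underS r a"
          using f[OF a(1)] a underX \<delta>(2) unfolding Y_def bij_betw_def by (auto dest: inj_onD)
        then show ?thesis using card_of_underS[OF Cr, of a] a Fr by (simp add: r_def)
      qed
      have Y_mono: "Y i \<subseteq> Y j" if "ordinal j" "i \<in> elts j" for i j
        using ordinal_trans[OF that] by (auto simp: Y_def)
      have Y_dir: "\<exists>k\<in>elts \<gamma>. Y i \<subseteq> Y k \<and> Y j \<subseteq> Y k" if "ordinal \<gamma>" "i \<in> elts \<gamma>" "j \<in> elts \<gamma>" for i j \<gamma>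
        using ordinal_linear[of i j] ordinal_memD[OF that(1)] that Y_mono by (metis subset_refl)
      have Y_union: "(\<Union>i\<in>elts \<gamma>. Y i) = Y \<gamma>" if "limit_ordinal \<gamma>" for \<gamma>
        using that ordinal_trans unfolding limit_ordinal_def Y_def by blast
      have hull_union: "union_structure (\<lambda>i. pure_hull A (Y i)) (elts \<gamma>) = pure_hull A (Y \<gamma>)"
        if \<gamma>: "limit_ordinal \<gamma>" for \<gamma>
      proof -
        have "ordinal \<gamma>" "elts \<gamma> \<noteq> {}" using \<gamma> by (auto simp: limit_ordinal_def)
        then show ?thesis
          using union_pure_hull[OF A small_elts _ YA Y_dir, of \<gamma>] Y_union[OF \<gamma>] by simp
      qed
      have hull_S: "(pure_hull A (Y i), A) \<in> S" for i using pure_hull_pure[OF A YA] pureS by blast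
      have "continuous_chain S \<delta> (\<lambda>i. pure_hull A (Y i))"
        unfolding continuous_chain_def
      proof (intro conjI ballI impI)
        fix j i assume j: "j \<in> elts \<delta>" and i: "i \<in> elts j"
        have "(pure_hull A (Y i), pure_hull A (Y j)) \<in> submodule_rel"
          by (rule pure_hull_mono[OF A Y_mono[OF ordinal_memD[OF \<delta>(1) j] i] YA])
        then show "(pure_hull A (Y i), pure_hull A (Y j)) \<in> S"
          by (rule LZ_D(3)[OF SL hull_S hull_S])
      qed (simp add: hull_union)
      moreover have "\<forall>i\<in>elts \<delta>. pure_hull A (Y i) \<in> ZMod"
        using hull_S LZ_D(1)[OF SL] submodule_relD(1) by blast
      moreover have "\<forall>i\<in>elts \<delta>. (pure_hull A (Y i), B) \<in> S"
        using less.IH[of "Y _"] Y_less YA by (simp add: in_inv_image)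
      ultimately have "(union_structure (\<lambda>i. pure_hull A (Y i)) (elts \<delta>), B) \<in> S"
        by (intro LZ_D(5)[OF SL lim _ _ B])
      moreover have "Y \<delta> = X" using \<delta>(2) by (auto simp: Y_def bij_betw_def)
      ultimately show ?thesis using hull_union[OF lim] by simp
    qed
  qed
qed

text \<open>
  A countable pure subgroup of \<open>A\<close> lies in a countable pure subgroup of \<open>B\<close>; coherence of \<open>R\<close>
  yields the relation between these two countable groups, and transitivity of \<open>S\<close> brings it up
  to \<open>B\<close>. The previous lemma then replaces the countable subgroups of \<open>A\<close> by \<open>A\<close>.
\<close>

lemma LZ1_determined_by_countable:
  assumes R: "R \<in> LZ1" and S: "S \<in> LZ1"
    and RS: "\<And>A B. (A, B) \<in> R \<Longrightarrow> countable (carrier B) \<Longrightarrow> (A, B) \<in> S"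
  shows "R \<subseteq> S"
proof (rule subrelI)
  fix A B assume AB: "(A, B) \<in> R"
  have RL: "R \<in> LZ" "pure_rel \<subseteq> R" and SL: "S \<in> LZ" "pure_rel \<subseteq> S" using R S by (auto simp: LZ1_def)
  have sub: "(A, B) \<in> submodule_rel" using AB LZ_D(1)[OF RL(1)] by blast
  note D = submodule_relD[OF sub]
  have "(pure_hull A X, B) \<in> S" if X: "countable X" "X \<subseteq> carrier A" for X
  proof -
    let ?A = "pure_hull A X" let ?B = "pure_hull B (carrier ?A)"
    have A: "(?A, A) \<in> pure_rel" by (rule pure_hull_pure[OF D(1) X(2)])
    have A0: "(?A, B) \<in> R" using LZ_D(2)[OF RL(1)] A RL(2) AB by blast
    then have A1: "(?A, B) \<in> submodule_rel" using LZ_D(1)[OF RL(1)] by blast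
    have B: "(?B, B) \<in> pure_rel" by (rule pure_hull_pure[OF D(2) submodule_relD(4)[OF A1]])
    have "(?A, ?B) \<in> submodule_rel"
      using submodule_rel_within[OF A1 _ subset_pure_hull] B pure_rel_submodule by blast
    then have "(?A, ?B) \<in> R" using LZ_D(3)[OF RL(1) A0] B RL(2) by blast
    then have "(?A, ?B) \<in> S" by (rule RS) (intro countable_pure_hull X(1))
    then show ?thesis by (rule LZ_D(2)[OF SL(1) _ subsetD[OF SL(2) B]])
  qed
  then have "(pure_hull A (carrier A), B) \<in> S" by (rule pure_hull_rel[OF S D(1,2)]) auto
  moreover have "pure_hull A (carrier A) = A"
    using pure_hull_pure[OF D(1) subset_refl] pure_rel_submodule submodule_relD(4)
      submodule_rel_antisym submodule_rel_within[OF submodule_rel_refl[OF D(1)] _ subset_pure_hull]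
    by blast
  ultimately show "(A, B) \<in> S" by simp
qed

section \<open>Counting the relations containing purity\<close>

text \<open>
  A copy on the natural numbers of a countable group with a distinguished subgroup; pairs with the same
  code are isomorphic, whatever the injections are.
\<close>

definition code :: "('a \<Rightarrow> nat) \<Rightarrow> 'a monoid \<Rightarrow> 'a monoid \<Rightarrow> nat set \<times> nat set \<times> (nat \<times> nat \<times> nat) set" where
  "code e A B = (e ` carrier A, e ` carrier B,
     {(e x, e y, e (x \<otimes>\<^bsub>B\<^esub> y)) | x y. x \<in> carrier B \<and> y \<in> carrier B})"

lemma code_eq_iso:
  assumes AB: "(A, B) \<in> submodule_rel" and AB': "(A', B') \<in> submodule_rel"
    and e: "inj_on e (carrier B)" and e': "inj_on e' (carrier B')" and eq: "code e A B = code e' A' B'"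
  obtains h where "h \<in> iso B' B" "h \<in> iso A' A"
proof -
  interpret B: group B using submodule_relD(2)[OF AB] by (rule ZMod_group)
  interpret B': group B' using submodule_relD(2)[OF AB'] by (rule ZMod_group)
  interpret A': group A' using submodule_relD(1)[OF AB'] by (rule ZMod_group)
  have im: "e ` carrier A = e' ` carrier A'" "e ` carrier B = e' ` carrier B'"
    using eq by (simp_all add: code_def)
  define h where "h x = inv_into (carrier B) e (e' x)" for x
  have h: "h x \<in> carrier B" "e (h x) = e' x" if "x \<in> carrier B'" for x
    using that im(2) unfolding h_def by (auto intro!: inv_into_into f_inv_into_f)
  have hmult: "h (x \<otimes>\<^bsub>B'\<^esub> y) = h x \<otimes>\<^bsub>B\<^esub> h y" if xy: "x \<in> carrier B'" "y \<in> carrier B'" for x y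
  proof -
    have "(e' x, e' y, e' (x \<otimes>\<^bsub>B'\<^esub> y)) \<in> snd (snd (code e A B))"
      using xy unfolding eq by (auto simp: code_def)
    then obtain a b where ab: "a \<in> carrier B" "b \<in> carrier B" "e a = e' x" "e b = e' y"
      "e (a \<otimes>\<^bsub>B\<^esub> b) = e' (x \<otimes>\<^bsub>B'\<^esub> y)"
      by (auto simp: code_def)
    then have "a = h x" "b = h y" "a \<otimes>\<^bsub>B\<^esub> b = h (x \<otimes>\<^bsub>B'\<^esub> y)"
      using h xy by (auto intro!: inj_onD[OF e])
    then show ?thesis by simp
  qed
  have inj: "inj_on h (carrier B')"
    by (rule inj_onI) (metis h(2) e' inj_onD)
  have imB: "h ` carrier B' = carrier B"
  proof
    show "carrier B \<subseteq> h ` carrier B'"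
    proof
      fix b assume b: "b \<in> carrier B"
      then obtain x where x: "x \<in> carrier B'" "e b = e' x" using im(2) by blast
      then have "b = h x" using h[OF x(1)] b by (auto intro: inj_onD[OF e])
      then show "b \<in> h ` carrier B'" using x by blast
    qed
  qed (use h in auto)
  have subs: "carrier A \<subseteq> carrier B" "carrier A' \<subseteq> carrier B'" using AB AB' submodule_relD(4) by blast+
  have imA: "h ` carrier A' = carrier A"
  proof (intro equalityI subsetI)
    fix a assume "a \<in> h ` carrier A'"
    then obtain x where x: "x \<in> carrier A'" "a = h x" by blast
    then obtain a' where a': "a' \<in> carrier A" "e a' = e' x" using im(1) by (metis imageE imageI)
    then have "a' = a" using x h[of x] subs by (auto intro!: inj_onD[OF e])
    then show "a \<in> carrier A" using a' by simp
  next
    fix a assume a: "a \<in> carrier A"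
    then obtain x where x: "x \<in> carrier A'" "e a = e' x" using im(1) by (metis imageE imageI)
    then have "a = h x" using a h[of x] subs by (auto intro!: inj_onD[OF e])
    then show "a \<in> h ` carrier A'" using x by blast
  qed
  have "h \<in> iso B' B" using inj imB hmult by (auto simp: iso_def bij_betw_def hom_def)
  moreover have "h \<in> iso A' A"
    unfolding iso_def bij_betw_def hom_def
  proof (intro CollectI conjI ballI)
    show "inj_on h (carrier A')" using inj subs(2) by (rule inj_on_subset)
    show "h ` carrier A' = carrier A" by (rule imA)
    show "h \<in> carrier A' \<rightarrow> carrier A" using imA by auto
    fix x y assume xy: "x \<in> carrier A'" "y \<in> carrier A'"
    have hA: "h x \<in> carrier A" "h y \<in> carrier A" using imA xy by blast+
    have "h (x \<otimes>\<^bsub>A'\<^esub> y) = h (x \<otimes>\<^bsub>B'\<^esub> y)" using submodule_relD(5)[OF AB' xy] by simp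
    also have "\<dots> = h x \<otimes>\<^bsub>B\<^esub> h y" using hmult xy subs(2) by blast
    also have "\<dots> = h x \<otimes>\<^bsub>A\<^esub> h y" using submodule_relD(5)[OF AB hA] by simp
    finally show "h (x \<otimes>\<^bsub>A'\<^esub> y) = h x \<otimes>\<^bsub>A\<^esub> h y" .
  qed
  ultimately show thesis by (rule that)
qed

definition countable_codes :: "'v monoid rel \<Rightarrow> (nat set \<times> nat set \<times> (nat \<times> nat \<times> nat) set) set" where
  "countable_codes R = {code e A B | e A B. (A, B) \<in> R \<and> inj_on e (carrier B)}"

lemma countable_codes_subset:
  assumes R: "R \<in> LZ1" and S: "S \<in> LZ1" and eq: "countable_codes R \<subseteq> countable_codes S"
  shows "R \<subseteq> S"
proof (rule LZ1_determined_by_countable[OF R S])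
  have RL: "R \<in> LZ" and SL: "S \<in> LZ" using R S by (auto simp: LZ1_def)
  fix A B assume AB: "(A, B) \<in> R" and "countable (carrier B)"
  from this(2) have e: "inj_on (to_nat_on (carrier B)) (carrier B)" by (rule inj_on_to_nat_on)
  have "code (to_nat_on (carrier B)) A B \<in> countable_codes R"
    unfolding countable_codes_def using AB e by blast
  then have "code (to_nat_on (carrier B)) A B \<in> countable_codes S" using eq by blast
  then obtain e' A' B' where *: "code (to_nat_on (carrier B)) A B = code e' A' B'"
    "(A', B') \<in> S" "inj_on e' (carrier B')"
    by (auto simp: countable_codes_def)
  have sub: "(A, B) \<in> submodule_rel" "(A', B') \<in> submodule_rel"
    using AB * LZ_D(1)[OF RL] LZ_D(1)[OF SL] by auto
  obtain h where "h \<in> iso B' B" "h \<in> iso A' A"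
    using code_eq_iso[OF sub e *(3,1)] by blast
  then show "(A, B) \<in> S" using LZ_D(4)[OF SL *(2)] submodule_relD(1,2)[OF sub(1)] by blast
qed

theorem card_LZ1: "|LZ1 :: 'v::set_universe monoid rel set| \<le>o ctwo ^c (ctwo ^c natLeq)"
proof -
  define g :: "nat set \<times> nat set \<times> (nat \<times> nat \<times> nat) set \<Rightarrow> nat \<Rightarrow> bool" where
    "g = (\<lambda>(a, b, c) n. case from_nat n :: nat + nat + nat \<times> nat \<times> nat of
       Inl x \<Rightarrow> x \<in> a | Inr (Inl x) \<Rightarrow> x \<in> b | Inr (Inr t) \<Rightarrow> t \<in> c)"
  have "inj g"
  proof (rule injI)
    fix s t assume eq: "g s = g t"
    obtain a b c a' b' c' where st: "s = (a, b, c)" "t = (a', b', c')" by (cases s, cases t) auto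
    have "x \<in> a \<longleftrightarrow> x \<in> a'" for x using fun_cong[OF eq, of "to_nat (Inl x :: nat + nat + nat \<times> nat \<times> nat)"] by (simp add: g_def st)
    moreover have "x \<in> b \<longleftrightarrow> x \<in> b'" for x using fun_cong[OF eq, of "to_nat (Inr (Inl x) :: nat + nat + nat \<times> nat \<times> nat)"] by (simp add: g_def st)
    moreover have "x \<in> c \<longleftrightarrow> x \<in> c'" for x using fun_cong[OF eq, of "to_nat (Inr (Inr x) :: nat + nat + nat \<times> nat \<times> nat)"] by (simp add: g_def st)
    ultimately show "s = t" using st by auto
  qed
  define \<Phi> :: "'v monoid rel \<Rightarrow> (nat \<Rightarrow> bool) \<Rightarrow> bool" where "\<Phi> R = (\<lambda>P. P \<in> g ` countable_codes R)" for R
  have "inj_on \<Phi> LZ1"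
  proof (rule inj_onI)
    fix R S :: "'v monoid rel" assume RS: "R \<in> LZ1" "S \<in> LZ1" "\<Phi> R = \<Phi> S"
    then have "g ` countable_codes R = g ` countable_codes S"
      by (auto simp: \<Phi>_def fun_eq_iff)
    then have "countable_codes R = countable_codes S" using \<open>inj g\<close> by (simp add: inj_image_eq_iff)
    then show "R = S" using RS countable_codes_subset by (metis equalityI order_refl)
  qed
  then have "|LZ1 :: 'v monoid rel set| \<le>o |UNIV :: ((nat \<Rightarrow> bool) \<Rightarrow> bool) set|"
    using card_of_ordLeq by blast
  moreover have "ctwo ^c (ctwo ^c natLeq) = |UNIV :: ((nat \<Rightarrow> bool) \<Rightarrow> bool) set|"
    by (simp add: cexp_def ctwo_def Field_card_of Field_natLeq Func_def)
  ultimately show ?thesis by simp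
qed

section \<open>An antichain of relations containing purity\<close>

lemma ex_copy_in_ZMod:
  fixes G :: "'a monoid" and x :: "'v::set_universe"
  assumes G: "comm_group G" and card: "|carrier G| \<le>o |elts x|"
  obtains H :: "'v monoid" and h where "H \<in> ZMod" "h \<in> iso G H"
proof -
  interpret G: comm_group G by fact
  obtain f where f: "inj_on f (carrier G)" "f ` carrier G \<subseteq> elts x"
    using card card_of_ordLeq by metis
  define g where "g = inv_into (carrier G) f"
  have gf: "g (f a) = a" if "a \<in> carrier G" for a using f(1) that by (simp add: g_def)
  define C where "C = f ` carrier G"
  define H where "H = \<lparr>carrier = C,
    monoid.mult = (\<lambda>x y. if x \<in> C \<and> y \<in> C then f (g x \<otimes>\<^bsub>G\<^esub> g y) else undefined),
    monoid.one = f \<one>\<^bsub>G\<^esub>\<rparr>"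
  have H: "carrier H = C" "\<one>\<^bsub>H\<^esub> = f \<one>\<^bsub>G\<^esub>" by (simp_all add: H_def)
  have fm: "f a \<otimes>\<^bsub>H\<^esub> f b = f (a \<otimes>\<^bsub>G\<^esub> b)" if "a \<in> carrier G" "b \<in> carrier G" for a b
    using that by (simp add: H_def C_def gf)
  have "comm_group H"
  proof (rule comm_groupI)
    fix x assume "x \<in> carrier H"
    then obtain a where a: "a \<in> carrier G" "x = f a" by (auto simp: H C_def)
    then show "\<exists>y\<in>carrier H. y \<otimes>\<^bsub>H\<^esub> x = \<one>\<^bsub>H\<^esub>"
      by (intro bexI[of _ "f (inv\<^bsub>G\<^esub> a)"]) (auto simp: fm H C_def)
  qed (auto simp: fm H C_def G.m_assoc, metis G.m_comm)
  moreover have "small C" using small_subset[OF small_elts f(2)] by (simp add: C_def)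
  ultimately have "H \<in> ZMod" by (auto simp: ZMod_def small_def H_def)
  moreover have "f \<in> iso G H" using f(1) fm by (auto simp: iso_def hom_def bij_betw_def H C_def)
  ultimately show thesis by (rule that)
qed

text \<open>
  The empty set is the ordinal zero, so the isotype relation of this index set says
  $pA = A \<inter> pB$ for \<open>p \<in> S\<close>.
\<close>

definition prime_index :: "nat set \<Rightarrow> (nat \<times> 'v::set_universe) set" where
  "prime_index S = {(p, w). p \<in> S \<and> elts w = {}}"

lemma ulm_divisible_empty:
  assumes "elts w = {}"
  shows "ulm_divisible p G w a \<longleftrightarrow> (\<exists>c\<in>carrier G. c [^]\<^bsub>G\<^esub> p = a)"
proof
  assume "ulm_divisible p G w a"
  then show "\<exists>c\<in>carrier G. c [^]\<^bsub>G\<^esub> p = a" by (elim ulm_divisibleE) (rule bexI)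
next
  assume "\<exists>c\<in>carrier G. c [^]\<^bsub>G\<^esub> p = a"
  then obtain c where "c \<in> carrier G" "c [^]\<^bsub>G\<^esub> p = a" by blast
  then show "ulm_divisible p G w a" using ulm_divisible.root[of c G w p] assms by simp
qed

lemma pure_relD:
  assumes "(A, B) \<in> pure_rel" "\<forall>i<m. a i \<in> carrier A" "solves B m n r a x"
  obtains y where "solves A m n r a y"
proof -
  have "\<forall>m n r a. (\<forall>i<m. a i \<in> carrier A) \<longrightarrow> (\<exists>x. solves B m n r a x) \<longrightarrow> (\<exists>x. solves A m n r a x)"
    using assms(1) by (simp add: pure_rel_def)
  from this[THEN spec[of _ m], THEN spec[of _ n], THEN spec[of _ r], THEN spec[of _ a]]
  have "\<exists>x. solves A m n r a x" using assms(2,3) by blast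
  then show thesis using that by blast
qed

text \<open>
  The equation $p x = a$ is a linear system.
\<close>

lemma pure_subset_isotype_rel: "pure_rel \<subseteq> isotype_rel (prime_index S)"
proof (rule subrelI, rule isotype_relI)
  fix A B :: "'a monoid" assume AB: "(A, B) \<in> pure_rel"
  then show sub: "(A, B) \<in> submodule_rel" using pure_rel_submodule by blast
  interpret A: comm_group A using submodule_relD(1)[OF sub] by (rule ZMod_comm_group)
  interpret B: comm_group B using submodule_relD(2)[OF sub] by (rule ZMod_comm_group)
  fix p and w :: 'a and a
  assume I: "(p, w) \<in> prime_index S" and a: "a \<in> carrier A" and "ulm_divisible p B w a"
  then have w: "elts w = {}" and "\<exists>c\<in>carrier B. c [^]\<^bsub>B\<^esub> p = a"
    by (auto simp: prime_index_def ulm_divisible_empty)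
  then obtain c where c: "c \<in> carrier B" "c [^]\<^bsub>B\<^esub> p = a" by blast
  have "a \<in> carrier B" using a submodule_relD(4)[OF sub] by blast
  then have "solves B 1 1 (\<lambda>_ _. int p) (\<lambda>_. a) (\<lambda>_. c)"
    using c by (simp add: solves_def int_pow_int lessThan_Suc)
  then obtain x where "solves A 1 1 (\<lambda>_ _. int p) (\<lambda>_. a) x"
    by (rule pure_relD[OF AB, rotated]) (use a in auto)
  then have "x 0 \<in> carrier A" "x 0 [^]\<^bsub>A\<^esub> p = a"
    by (auto simp: solves_def int_pow_int lessThan_Suc)
  then show "ulm_divisible p A w a" unfolding ulm_divisible_empty[OF w] by blast
qed

lemma isotype_rel_prime_index_in_LZ1: "isotype_rel (prime_index S :: (nat \<times> 'v::set_universe) set) \<in> LZ1"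
proof -
  obtain l :: 'v where l: "infinite (elts l)" using infinity by blast
  have "hereditary (prime_index S :: (nat \<times> 'v) set)" by (auto simp: hereditary_def prime_index_def)
  moreover have "|prime_index S :: (nat \<times> 'v) set| \<le>o |elts l|"
  proof -
    have "inj_on fst (prime_index S :: (nat \<times> 'v) set)"
      by (auto simp: inj_on_def prime_index_def intro: extensionality)
    then have "|prime_index S :: (nat \<times> 'v) set| \<le>o |UNIV :: nat set|"
      using card_of_ordLeq by blast
    moreover have "|UNIV :: nat set| \<le>o |elts l|" using l infinite_iff_card_of_nat by blast
    ultimately show ?thesis by (rule ordLeq_transitive)
  qed
  ultimately show ?thesis
    using isotype_rel_in_LZ[OF _ l] pure_subset_isotype_rel by (auto simp: LZ1_def)
qed

text \<open>
  For a prime \<open>p\<close> in \<open>S\<close> but not in \<open>T\<close>, the subgroup $p\mathbb{Z}$ of $\mathbb{Z}$ separates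
  the two relations: $q\mathbb{Z} \<inter> p\mathbb{Z} = qp\mathbb{Z}$ for every prime
  $q \<noteq> p$, whereas \<open>p\<close> is divisible by \<open>p\<close> in $\mathbb{Z}$ and not in $p\mathbb{Z}$.
\<close>

lemma isotype_rel_prime_index_subsetD:
  assumes S: "\<And>p. p \<in> S \<Longrightarrow> prime p" and T: "\<And>p. p \<in> T \<Longrightarrow> prime p"
    and sub: "isotype_rel (prime_index T :: (nat \<times> 'v::set_universe) set) \<subseteq> isotype_rel (prime_index S)"
  shows "S \<subseteq> T"
proof (rule ccontr)
  let ?Z = "integer_group :: int monoid"
  assume "\<not> S \<subseteq> T"
  then obtain p where p: "p \<in> S" "p \<notin> T" by blast
  obtain l :: 'v where l: "infinite (elts l)" using infinity by blast
  have "|carrier ?Z| \<le>o |elts l|"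
  proof -
    have 1: "|UNIV :: int set| \<le>o |UNIV :: nat set|" using countable_iff_card_le_nat[of "UNIV :: int set"] by simp
    have 2: "|UNIV :: nat set| \<le>o |elts l|" using l infinite_iff_card_of_nat by blast
    show ?thesis unfolding carrier_integer_group by (rule ordLeq_transitive[OF 1 2])
  qed
  then obtain H :: "'v monoid" and h where H: "H \<in> ZMod" and h: "h \<in> iso ?Z H"
    using ex_copy_in_ZMod[OF abelian_integer_group] by blast
  interpret H: comm_group H using H by (rule ZMod_comm_group)
  interpret h: group_hom ?Z H h
    using h by (intro group_hom.intro group_hom_axioms.intro) (auto simp: iso_def)
  have inj: "h m = h n \<longleftrightarrow> m = n" for m n using h by (auto simp: iso_def bij_betw_def inj_on_def)
  have surj: "carrier H = range h" using h by (auto simp: iso_def bij_betw_def)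
  have pow: "h n [^]\<^bsub>H\<^esub> (q::nat) = h (int q * n)" for n q
    using h.hom_nat_pow[of n q] by simp
  define C where "C = h ` {n. int p dvd n}"
  have "subgroup {n. int p dvd n} ?Z"
    by (rule group.subgroupI) auto
  then have C: "subgroup C H" unfolding C_def by (rule h.subgroup_img_is_subgroup)
  define A where "A = induced H C"
  have AH: "(A, H) \<in> submodule_rel" unfolding A_def by (rule induced_submodule_rel[OF H C])
  have cA: "carrier A = C" by (simp add: A_def)
  have "(A, H) \<in> isotype_rel (prime_index T)"
  proof (rule isotype_relI[OF AH])
    fix q a and w :: 'v
    assume qw: "(q, w) \<in> prime_index T" and a: "a \<in> carrier A" and div: "ulm_divisible q H w a"
    from qw have q: "q \<in> T" and w: "elts w = {}" by (auto simp: prime_index_def)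
    obtain n where n: "h n [^]\<^bsub>H\<^esub> q = a"
      using div unfolding ulm_divisible_empty[OF w] surj by blast
    obtain k where k: "int p dvd k" "a = h k" using a unfolding cA C_def by blast
    have "int q * n = k" using n k by (simp add: pow inj)
    moreover have "coprime (int p) (int q)"
      using p q S T primes_coprime[of p q] by auto
    ultimately have "int p dvd n" using k(1) coprime_dvd_mult_right_iff by blast
    then have "h n \<in> carrier A" by (auto simp: cA C_def)
    moreover have "h n [^]\<^bsub>A\<^esub> q = a" using submodule_rel_nat_pow[OF AH calculation] n by simp
    ultimately show "ulm_divisible q A w a" unfolding ulm_divisible_empty[OF w] by blast
  qed
  then have AS: "(A, H) \<in> isotype_rel (prime_index S)" using sub by blast
  obtain w :: 'v where w: "elts w = {}" using smallE[OF small_empty] by blast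
  have "ulm_divisible p H w (h (int p))"
    unfolding ulm_divisible_empty[OF w] using pow[of 1 p] surj by auto
  moreover have "h (int p) \<in> carrier A" by (auto simp: cA C_def)
  moreover have "(p, w) \<in> prime_index S" using p w by (simp add: prime_index_def)
  ultimately have "ulm_divisible p A w (h (int p))" using isotype_relD(2)[OF AS] by blast
  then obtain c where c: "c \<in> carrier A" "c [^]\<^bsub>A\<^esub> p = h (int p)"
    unfolding ulm_divisible_empty[OF w] by blast
  then obtain m where m: "c = h (int p * m)" by (auto simp: cA C_def)
  have "h (int p * (int p * m)) = h (int p)"
    using c submodule_rel_nat_pow[OF AH c(1)] m pow by simp
  then have "int p * (int p * m) = int p" by (simp add: inj)
  moreover have "prime p" using S p by blast
  ultimately have "int p * m = 1" using prime_gt_0_nat[of p] by simp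
  then have "p = 1" by (metis dvd_triv_left int_dvd_int_iff nat_dvd_1_iff_1 of_nat_1)
  then show False using \<open>prime p\<close> by simp
qed

text \<open>
  A set of natural numbers selects one prime out of each of infinitely many disjoint pairs. Distinct
  selections are incomparable sets of primes.
\<close>

theorem uncountable_antichain:
  "\<exists>\<A> \<subseteq> (LZ1 :: 'v::set_universe monoid rel set). uncountable \<A> \<and>
     (\<forall>R\<in>\<A>. \<forall>S\<in>\<A>. R \<noteq> S \<longrightarrow> \<not> le_LZ R S)"
proof -
  define e where "e = enumerate {p::nat. prime p}"
  have inf: "infinite {p::nat. prime p}" by (rule primes_infinite)
  have e_prime: "prime (e n)" for n using enumerate_in_set[OF inf] by (auto simp: e_def)
  have e_inj: "e m = e n \<longleftrightarrow> m = n" for m n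
    using enumerate_mono_iff[OF inf] by (metis e_def less_irrefl linorder_neqE)
  define P where "P X = {e (2 * n) | n. n \<in> X} \<union> {e (2 * n + 1) | n. n \<notin> X}" for X
  have P_prime: "prime p" if "p \<in> P X" for p X using that e_prime by (auto simp: P_def)
  have P: "X = Y" if XY: "P X \<subseteq> P Y" for X Y
  proof -
    have even: "e (2 * n) \<in> P X \<longleftrightarrow> n \<in> X" and odd: "e (2 * n + 1) \<in> P X \<longleftrightarrow> n \<notin> X" for n X
      unfolding P_def by (auto simp: e_inj) presburger+
    show ?thesis using XY even odd by blast
  qed
  define F where "F X = isotype_rel (prime_index (P X) :: (nat \<times> 'v) set)" for X
  have F: "X = Y" if "F X \<subseteq> F Y" for X Y
  proof -
    have "P Y \<subseteq> P X"
      using isotype_rel_prime_index_subsetD[OF _ _ that[unfolded F_def]] P_prime by blast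
    then show ?thesis using P by blast
  qed
  have "inj F" by (rule injI) (rule F, simp)
  have "uncountable (range F)"
  proof
    assume "countable (range F)"
    then have "countable (UNIV :: nat set set)" using countable_image_inj_on[OF _ \<open>inj F\<close>] by simp
    then obtain g :: "nat set \<Rightarrow> nat" where "inj g" by (rule countableE)
    then have "inv_into UNIV g ` UNIV = Pow UNIV" using inj_imp_surj_inv by auto
    then show False using Cantors_theorem by blast
  qed
  moreover have "range F \<subseteq> LZ1" using isotype_rel_prime_index_in_LZ1 by (auto simp: F_def)
  moreover have "\<not> le_LZ R S" if "R \<in> range F" "S \<in> range F" "R \<noteq> S" for R S
    using that F unfolding le_LZ_def by blast
  ultimately show ?thesis by (intro exI[of _ "range F"] conjI ballI impI)
qed

section \<open>Reduced groups of unbounded length\<close>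

definition child_sum :: "('v::set_universe list \<Rightarrow> rat) \<Rightarrow> 'v list \<Rightarrow> rat" where
  "child_sum f v = (\<Sum>b | b \<in> elts (hd v) \<and> f (b # v) \<noteq> 0. f (b # v))"

text \<open>
  The nodes of a forest are the non-empty lists of elements of \<open>X\<close>; the children of a node \<open>v\<close>
  are the \<open>b # v\<close> with \<open>b \<in> hd v\<close>, so that there is no infinite branch. The group consists of the
  finitely supported functions \<open>f\<close> from nodes to $\mathbb{Q}/\mathbb{Z}$ for which $2 f(v)$ is the sum of the
  values of \<open>f\<close> at the children of \<open>v\<close>; elements of $\mathbb{Q}/\mathbb{Z}$ are represented in the unit
  interval. For every descending list \<open>u\<close> the group contains an element \<open>tree_elem u\<close>, and twice this
  element is the one of the parent of \<open>u\<close>, or zero if \<open>u\<close> is a root. In an abstract presentation by these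
  relations it would be hard to see that there is no non-zero 2-divisible subgroup; in the concrete model
  the values at the children of a node control the value at the node.
\<close>

definition tree_group :: "'v::set_universe \<Rightarrow> ('v list \<Rightarrow> rat) monoid" where
  "tree_group X = \<lparr>carrier = {f. finite {v. f v \<noteq> 0} \<and> (\<forall>v. 0 \<le> f v \<and> f v < 1) \<and>
       (\<forall>v. f v \<noteq> 0 \<longrightarrow> v \<noteq> [] \<and> set v \<subseteq> elts X) \<and>
       (\<forall>v. v \<noteq> [] \<longrightarrow> 2 * f v - child_sum f v \<in> \<int>)},
     monoid.mult = (\<lambda>f g v. frac (f v + g v)), monoid.one = (\<lambda>_. 0)\<rparr>"

lemma in_tree_group_iff:
  "f \<in> carrier (tree_group X) \<longleftrightarrow> finite {v. f v \<noteq> 0} \<and> (\<forall>v. 0 \<le> f v \<and> f v < 1) \<and>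
     (\<forall>v. f v \<noteq> 0 \<longrightarrow> v \<noteq> [] \<and> set v \<subseteq> elts X) \<and>
     (\<forall>v. v \<noteq> [] \<longrightarrow> 2 * f v - child_sum f v \<in> \<int>)"
  by (simp add: tree_group_def)

lemma child_sum_eq:
  assumes "finite W" "W \<subseteq> elts (hd v)" "\<And>b. b \<in> elts (hd v) \<Longrightarrow> f (b # v) \<noteq> 0 \<Longrightarrow> b \<in> W"
  shows "child_sum f v = (\<Sum>b\<in>W. f (b # v))"
  unfolding child_sum_def by (rule sum.mono_neutral_left) (use assms in auto)

lemma finite_children:
  assumes "finite {v. f v \<noteq> (0::rat)}" shows "finite {b. f (b # v) \<noteq> 0}"
proof -
  have "(\<lambda>b. b # v) ` {b. f (b # v) \<noteq> 0} \<subseteq> {v. f v \<noteq> 0}" by auto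
  then have "finite ((\<lambda>b. b # v) ` {b. f (b # v) \<noteq> 0})" using assms finite_subset by blast
  then show ?thesis by (rule finite_imageD) (simp add: inj_on_def)
qed

text \<open>
  The balance condition is additive, and invariant under changing a function by integers; this gives
  closure under sums and inverses at once.
\<close>

lemma balance_combination:
  fixes f g h :: "'v::set_universe list \<Rightarrow> rat"
  assumes fin: "finite {v. f v \<noteq> 0}" "finite {v. g v \<noteq> 0}" "finite {v. h v \<noteq> 0}"
    and h: "\<And>v. f v + g v - h v \<in> \<int>"
    and f: "2 * f v - child_sum f v \<in> \<int>" and g: "2 * g v - child_sum g v \<in> \<int>"
  shows "2 * h v - child_sum h v \<in> \<int>"
proof -
  define W where "W = elts (hd v) \<inter> ({b. f (b # v) \<noteq> 0} \<union> {b. g (b # v) \<noteq> 0} \<union> {b. h (b # v) \<noteq> 0})"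
  have W: "finite W" "W \<subseteq> elts (hd v)" unfolding W_def using fin[THEN finite_children] by auto
  have s: "child_sum f v = (\<Sum>b\<in>W. f (b # v))" "child_sum g v = (\<Sum>b\<in>W. g (b # v))"
      "child_sum h v = (\<Sum>b\<in>W. h (b # v))"
    by (rule child_sum_eq[OF W], simp add: W_def)+
  have "2 * h v - child_sum h v = (2 * f v - child_sum f v) + (2 * g v - child_sum g v)
      - 2 * (f v + g v - h v) + (\<Sum>b\<in>W. f (b # v) + g (b # v) - h (b # v))"
    by (simp add: s sum.distrib sum_subtractf algebra_simps)
  also have "\<dots> \<in> \<int>"
    by (intro Ints_add Ints_diff Ints_mult Ints_sum f g h) auto
  finally show ?thesis .
qed

lemma comm_group_tree_group: "comm_group (tree_group X)"
proof (rule comm_groupI)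
  fix f g assume fg: "f \<in> carrier (tree_group X)" "g \<in> carrier (tree_group X)"
  let ?h = "f \<otimes>\<^bsub>tree_group X\<^esub> g"
  have "{v. ?h v \<noteq> 0} \<subseteq> {v. f v \<noteq> 0} \<union> {v. g v \<noteq> 0}"
    by (auto simp: tree_group_def)
  moreover have "finite ({v. f v \<noteq> 0} \<union> {v. g v \<noteq> 0})" using fg by (simp add: tree_group_def)
  ultimately have fin: "finite {v. ?h v \<noteq> 0}" by (rule finite_subset)
  have "2 * ?h v - child_sum ?h v \<in> \<int>" if "v \<noteq> []" for v
    by (rule balance_combination[of f g]) (use fg fin that in \<open>auto simp: tree_group_def frac_def\<close>)
  moreover have "?h v \<noteq> 0 \<Longrightarrow> v \<noteq> [] \<and> set v \<subseteq> elts X" for v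
    using fg by (cases "f v = 0 \<and> g v = 0") (auto simp: tree_group_def)
  moreover have "0 \<le> ?h v \<and> ?h v < 1" for v by (simp add: tree_group_def frac_lt_1)
  ultimately show "?h \<in> carrier (tree_group X)" unfolding in_tree_group_iff using fin by blast
  show "?h = g \<otimes>\<^bsub>tree_group X\<^esub> f" by (simp add: tree_group_def add.commute)
next
  show "\<one>\<^bsub>tree_group X\<^esub> \<in> carrier (tree_group X)" by (simp add: tree_group_def child_sum_def)
next
  fix f g h :: "'a list \<Rightarrow> rat"
  show "f \<otimes>\<^bsub>tree_group X\<^esub> g \<otimes>\<^bsub>tree_group X\<^esub> h = f \<otimes>\<^bsub>tree_group X\<^esub> (g \<otimes>\<^bsub>tree_group X\<^esub> h)"
    by (simp add: tree_group_def add.assoc)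
next
  fix f assume f: "f \<in> carrier (tree_group X)"
  then show "\<one>\<^bsub>tree_group X\<^esub> \<otimes>\<^bsub>tree_group X\<^esub> f = f"
    by (simp add: tree_group_def fun_eq_iff frac_eq)
  define g where "g v = frac (- f v)" for v
  have "{v. g v \<noteq> 0} \<subseteq> {v. f v \<noteq> 0}" by (auto simp: g_def)
  then have fin: "finite {v. g v \<noteq> 0}" using f finite_subset unfolding in_tree_group_iff by blast
  have fgz: "f v + g v - 0 \<in> \<int>" for v by (simp add: g_def frac_def)
  have "2 * g v - child_sum g v \<in> \<int>" if "v \<noteq> []" for v
  proof -
    have "2 * f v - child_sum f v \<in> \<int>" using f that unfolding in_tree_group_iff by blast
    then have "- (2 * f v - child_sum f v) \<in> \<int>" by (rule Ints_minus)
    also have "- (2 * f v - child_sum f v) = 2 * (- f v) - child_sum (\<lambda>v. - f v) v"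
      by (simp add: child_sum_def sum_negf)
    finally have m: "2 * (- f v) - child_sum (\<lambda>v. - f v) v \<in> \<int>" .
    show ?thesis
      by (rule balance_combination[of "\<lambda>v. - f v" "\<lambda>_. 0"])
        (use f fin m in \<open>auto simp: tree_group_def g_def frac_def child_sum_def\<close>)
  qed
  moreover have "g v \<noteq> 0 \<Longrightarrow> v \<noteq> [] \<and> set v \<subseteq> elts X" for v
    using f by (cases "f v = 0") (auto simp: tree_group_def g_def)
  moreover have "0 \<le> g v \<and> g v < 1" for v by (simp add: g_def frac_lt_1)
  ultimately have "g \<in> carrier (tree_group X)" unfolding in_tree_group_iff using fin by blast
  moreover have "g \<otimes>\<^bsub>tree_group X\<^esub> f = \<one>\<^bsub>tree_group X\<^esub>"
    using fgz by (simp add: tree_group_def fun_eq_iff add.commute)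
  ultimately show "\<exists>g\<in>carrier (tree_group X). g \<otimes>\<^bsub>tree_group X\<^esub> f = \<one>\<^bsub>tree_group X\<^esub>"
    by blast
qed

text \<open>
  If all functions in \<open>D\<close> vanish at the children of \<open>v\<close>, then the balance condition gives $2 c(v) = 0$
  for all of them; but every member of \<open>D\<close> is twice another one. So the vanishing propagates from
  the leaves of the well-founded forest to its roots.
\<close>

lemma tree_group_reduced:
  assumes D: "D \<subseteq> carrier (tree_group X)"
    and half: "\<And>d. d \<in> D \<Longrightarrow> \<exists>c\<in>D. c \<otimes>\<^bsub>tree_group X\<^esub> c = d"
  shows "d \<in> D \<Longrightarrow> d v = 0"
proof (induction v arbitrary: d rule: wf_induct_rule[OF wf_inv_image[OF foundation, of hd]])
  case (1 v)
  show ?case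
  proof (cases "v = []")
    case True
    then show ?thesis using 1(2) D by (auto simp: tree_group_def)
  next
    case False
    obtain c where c: "c \<in> D" "c \<otimes>\<^bsub>tree_group X\<^esub> c = d" using half 1(2) by blast
    have "c (b # v) = 0" if "b \<in> elts (hd v)" for b
      using 1(1)[of "b # v" c] c(1) that by (simp add: in_inv_image)
    then have "child_sum c v = 0" by (simp add: child_sum_def)
    moreover have "2 * c v - child_sum c v \<in> \<int>" using c(1) D False by (auto simp: tree_group_def)
    ultimately have "2 * c v \<in> \<int>" by simp
    then have "frac (c v + c v) = 0" by (simp add: frac_eq_0_iff)
    then show ?thesis using c(2) by (auto simp: tree_group_def)
  qed
qed

text \<open>
  The value at the ancestor of \<open>u\<close> that is \<open>k\<close> levels above \<open>u\<close> is $2^{-k-1}$, as it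
  arises from $(2 - \sigma)^{-1}$ applied to the unit vector at \<open>u\<close>, where \<open>\<sigma>\<close> moves a node to its parent.
\<close>

primrec tree_elem :: "'v list \<Rightarrow> 'v list \<Rightarrow> rat" where
  "tree_elem [] = (\<lambda>_. 0)"
| "tree_elem (b # u) = (\<lambda>v. if v = b # u then 1 / 2 else tree_elem u v / 2)"

lemma tree_elem_nonzero: "tree_elem u v \<noteq> 0 \<Longrightarrow> v \<noteq> [] \<and> length v \<le> length u \<and> set v \<subseteq> set u"
  by (induction u) (auto split: if_splits)

lemma tree_elem_finite: "finite {v. tree_elem u v \<noteq> 0}"
proof (induction u)
  case (Cons b u)
  have "{v. tree_elem (b # u) v \<noteq> 0} \<subseteq> insert (b # u) {v. tree_elem u v \<noteq> 0}" by auto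
  then show ?case using Cons finite_subset by blast
qed simp

lemma tree_elem_bounds: "0 \<le> tree_elem u v \<and> tree_elem u v \<le> 1 / 2"
  by (induction u) auto

lemma tree_elem_longer: "length u < length v \<Longrightarrow> tree_elem u v = 0"
  using tree_elem_nonzero[of u v] by linarith

lemma tree_elem_balance:
  assumes "successively (\<lambda>b a. b \<in> elts a) u" "v \<noteq> []" "v \<noteq> u"
  shows "2 * tree_elem u v = child_sum (tree_elem u) v"
  using assms
proof (induction u)
  case Nil
  then show ?case by (simp add: child_sum_def)
next
  case (Cons b u)
  show ?case
  proof (cases "v = u")
    case True
    then have b: "b \<in> elts (hd v)" using Cons.prems by (cases u) auto
    have "child_sum (tree_elem (b # u)) v = (\<Sum>b'\<in>{b}. tree_elem (b # u) (b' # v))"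
    proof (rule child_sum_eq)
      fix b' assume "tree_elem (b # u) (b' # v) \<noteq> 0"
      then show "b' \<in> {b}" using True tree_elem_longer[of u "b' # v"] by (auto split: if_splits)
    qed (use b in auto)
    moreover have "tree_elem u u = 1 / 2" using Cons.prems True by (cases u) auto
    ultimately show ?thesis using True by simp
  next
    case False
    have c: "tree_elem (b # u) (b' # v) = tree_elem u (b' # v) / 2" for b' using False by simp
    have "child_sum (tree_elem (b # u)) v = child_sum (tree_elem u) v / 2"
      unfolding child_sum_def c by (simp add: sum_divide_distrib)
    also have "child_sum (tree_elem u) v = 2 * tree_elem u v"
      using Cons False by (cases u) auto
    finally show ?thesis using Cons.prems by simp
  qed
qed

lemma tree_elem_in_tree_group:
  assumes u: "successively (\<lambda>b a. b \<in> elts a) u" "set u \<subseteq> elts X"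
  shows "tree_elem u \<in> carrier (tree_group X)"
proof -
  have "2 * tree_elem u v - child_sum (tree_elem u) v \<in> \<int>" if "v \<noteq> []" for v
  proof (cases "v = u")
    case True
    have "child_sum (tree_elem u) u = 0"
      unfolding child_sum_def by (simp add: tree_elem_longer)
    moreover have "2 * tree_elem u u = 1" using that True by (cases u) auto
    ultimately show ?thesis using True by simp
  next
    case False
    then show ?thesis using tree_elem_balance[OF u(1) that] by simp
  qed
  moreover have "0 \<le> tree_elem u v \<and> tree_elem u v < 1" for v using tree_elem_bounds[of u v] by linarith
  moreover have "v \<noteq> [] \<and> set v \<subseteq> elts X" if "tree_elem u v \<noteq> 0" for v
    using tree_elem_nonzero[OF that] u(2) by blast
  ultimately show ?thesis
    unfolding in_tree_group_iff using tree_elem_finite[of u] by blast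
qed

lemma tree_elem_double: "tree_elem (b # u) \<otimes>\<^bsub>tree_group X\<^esub> tree_elem (b # u) = tree_elem u"
proof
  fix v
  have "tree_elem u v < 1" using tree_elem_bounds[of u v] by linarith
  then show "(tree_elem (b # u) \<otimes>\<^bsub>tree_group X\<^esub> tree_elem (b # u)) v = tree_elem u v"
    using tree_elem_bounds[of u v] tree_elem_longer[of u "b # u"]
    by (auto simp: tree_group_def frac_eq)
qed

text \<open>
  The element at \<open>w # u\<close> halves the one at \<open>u\<close>, and by induction on \<open>w\<close> it is divisible along every
  \<open>v \<in> w\<close> itself.
\<close>

lemma tree_elem_ulm_divisible:
  assumes X: "transitive_set X"
  shows "successively (\<lambda>b a. b \<in> elts a) (w # u) \<Longrightarrow> set (w # u) \<subseteq> elts X \<Longrightarrow>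
    ulm_divisible 2 (tree_group X) w (tree_elem u)"
proof (induction w arbitrary: u rule: wf_induct_rule[OF foundation])
  case (1 w)
  interpret T: comm_group "tree_group X" by (rule comm_group_tree_group)
  let ?c = "tree_elem (w # u)"
  have c: "?c \<in> carrier (tree_group X)" by (rule tree_elem_in_tree_group[OF 1(2,3)])
  have "ulm_divisible 2 (tree_group X) v ?c" if "v \<in> elts w" for v
    using 1 that X by (intro 1(1)) (auto simp: transitive_set_def)
  then have "ulm_divisible 2 (tree_group X) w (?c [^]\<^bsub>tree_group X\<^esub> (2::nat))"
    using c by (intro ulm_divisible.root) auto
  moreover have "?c [^]\<^bsub>tree_group X\<^esub> (2::nat) = tree_elem u"
    using c tree_elem_double[where b = w and u = u and X = X] by (simp only: numeral_2_eq_2 T.nat_pow_Suc T.nat_pow_0 T.l_one)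
  ultimately show ?case by simp
qed

text \<open>
  A member is determined by the graph of its restriction to the support, which is a subset of a
  set of size at most $|X| + \<aleph>_0$.
\<close>

lemma tree_group_small:
  obtains y :: "'v::set_universe" where "|carrier (tree_group (X :: 'v))| \<le>o |elts y|"
proof -
  obtain z :: 'v where z: "infinite (elts z)" "|elts X| \<le>o |elts z|" by (rule ex_infinite_ge)
  have "|UNIV :: rat set| \<le>o |UNIV :: nat set|" using countable_iff_card_le_nat[of "UNIV :: rat set"] by simp
  moreover have "|UNIV :: nat set| \<le>o |elts z|" using z(1) infinite_iff_card_of_nat by blast
  ultimately have rat: "|UNIV :: rat set| \<le>o |elts z|" by (rule ordLeq_transitive)
  have "|lists (elts X) \<times> (UNIV :: rat set)| \<le>o |elts z|"
    by (rule card_of_Sigma_ordLeq_infinite[OF z(1) card_lists_le[OF z]]) (use rat in simp)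
  then obtain g where g: "inj_on g (lists (elts X) \<times> (UNIV :: rat set))"
    "g ` (lists (elts X) \<times> UNIV) \<subseteq> elts z"
    using card_of_ordLeq by metis
  define graph where "graph f = {(v, f v) | v. f v \<noteq> (0::rat)}" for f :: "'v list \<Rightarrow> rat"
  have sub: "graph f \<subseteq> lists (elts X) \<times> UNIV" if "f \<in> carrier (tree_group X)" for f
    using that by (auto simp: graph_def tree_group_def)
  have graph_inj: "f = f'" if "graph f = graph f'" for f f'
  proof
    fix v
    have "(v, f v) \<in> graph f' \<or> f v = 0" "(v, f' v) \<in> graph f \<or> f' v = 0"
      using that unfolding graph_def by auto
    then show "f v = f' v" by (auto simp: graph_def)
  qed
  have "inj_on (\<lambda>f. g ` graph f) (carrier (tree_group X))"
    by (rule inj_onI, rule graph_inj) (use inj_on_image_eq_iff[OF g(1)] sub in blast)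
  moreover have "(\<lambda>f. g ` graph f) ` carrier (tree_group X) \<subseteq> Pow (elts z)"
    using g(2) sub by blast
  ultimately have c: "|carrier (tree_group X)| \<le>o |Pow (elts z)|" using card_of_ordLeq by blast
  obtain y :: 'v where "|Pow (elts z)| \<le>o |elts y|" by (rule small_Pow)
  then show thesis using that ordLeq_transitive[OF c] by blast
qed

section \<open>A proper class of relations\<close>

definition ulm_rel :: "'v::set_universe \<Rightarrow> 'v monoid rel" where
  "ulm_rel \<alpha> = isotype_rel ({2} \<times> elts \<alpha>)"

lemma ulm_rel_antimono: "elts \<alpha> \<subseteq> elts \<beta> \<Longrightarrow> ulm_rel \<beta> \<subseteq> ulm_rel \<alpha>"
  unfolding ulm_rel_def isotype_rel_def by blast

lemma hereditary_ordinal: "ordinal \<alpha> \<Longrightarrow> hereditary ({p} \<times> elts \<alpha>)"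
  using ordinal_trans by (auto simp: hereditary_def)

lemma card_index_le: "|elts \<alpha>| \<le>o |K| \<Longrightarrow> |{p} \<times> elts \<alpha>| \<le>o |K|"
proof -
  assume "|elts \<alpha>| \<le>o |K|"
  moreover have "{p} \<times> elts \<alpha> = Pair p ` elts \<alpha>" by auto
  ultimately show ?thesis using card_of_image ordLeq_transitive by metis
qed

lemma ulm_rel_in_LZ:
  fixes \<alpha> :: "'v::set_universe"
  assumes "ordinal \<alpha>" shows "ulm_rel \<alpha> \<in> LZ"
proof -
  obtain l :: 'v where l: "infinite (elts l)" "|elts \<alpha>| \<le>o |elts l|" by (rule ex_infinite_ge)
  show ?thesis unfolding ulm_rel_def
    by (rule isotype_rel_in_LZ[OF hereditary_ordinal[OF assms] l(1) card_index_le[OF l(2)]])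
qed

text \<open>
  Suppose that the relations do not change any more above \<open>\<alpha>\<close>. Then the Loewenheim-Skolem number
  \<open>l\<close> of the relation at \<open>\<alpha>\<close> serves for all of them. In a tree group with a root \<open>t\<close> labelled by
  an ordinal \<open>\<gamma>\<close> of larger size than \<open>l\<close>, take a subgroup \<open>A\<close> of size at most \<open>l\<close> that contains \<open>t\<close> and
  is isotype up to \<open>\<gamma>\<close>. Then \<open>t\<close> is in $2^\delta A$ for every \<open>\<delta> < \<gamma>\<close>. The descending
  sequence of the $2^\delta A$ is too long to decrease strictly at all \<open>\<delta> < \<gamma>\<close>,
  and where it is stationary it is a 2-divisible group containing \<open>t\<close>, which is impossible in the tree group.
\<close>

lemma ex_stronger_ulm_rel:
  fixes \<alpha> :: "'v::set_universe"
  assumes \<alpha>: "ordinal \<alpha>"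
  obtains \<beta> :: 'v where "ordinal \<beta>" "elts \<alpha> \<subseteq> elts \<beta>" "ulm_rel \<beta> \<noteq> ulm_rel \<alpha>"
proof -
  obtain l :: 'v where l: "infinite (elts l)" "|elts \<alpha>| \<le>o |elts l|" by (rule ex_infinite_ge)
  obtain \<gamma> :: 'v where \<gamma>: "ordinal \<gamma>" "|elts l| <o |elts \<gamma>|" by (rule ex_large_ordinal)
  obtain X where X: "ordinal X" "elts X = insert \<gamma> (elts \<gamma>)" by (rule ordinal_succ[OF \<gamma>(1)])
  obtain \<beta> where \<beta>: "ordinal \<beta>" "elts \<beta> = elts \<alpha> \<union> elts X"
  proof (rule ordinal_UN[of "{\<alpha>, X}" "\<lambda>x. x"])
    show "small {\<alpha>, X}" by (intro small_insert small_empty)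
  qed (use \<alpha> X in auto)
  let ?T = "tree_group X" and ?t = "tree_elem [\<gamma>]"
  interpret T: comm_group ?T by (rule comm_group_tree_group)
  obtain y :: 'v where y: "|carrier ?T| \<le>o |elts y|" by (rule tree_group_small)
  obtain B :: "'v monoid" and h where B: "B \<in> ZMod" and h: "h \<in> iso ?T B"
    by (rule ex_copy_in_ZMod[OF comm_group_tree_group y])
  interpret B: comm_group B using B by (rule ZMod_comm_group)
  have hom: "h \<in> hom ?T B" and inj: "inj_on h (carrier ?T)" and surj: "carrier B = h ` carrier ?T"
    using h by (auto simp: iso_def bij_betw_def)
  have t: "?t \<in> carrier ?T" by (rule tree_elem_in_tree_group) (auto simp: X)
  have "{h ?t} \<subseteq> carrier B" using t surj by blast
  from isotype_rel_LS[OF hereditary_ordinal[OF \<alpha>, of 2] l(1) card_index_le[OF l(2)] B this]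
  obtain A where A: "h ?t \<in> carrier A" "(A, B) \<in> ulm_rel \<alpha>" "|carrier A| \<le>o |{h ?t}| +c |elts l|"
    unfolding ulm_rel_def by auto
  have "|{h ?t} <+> elts l| \<le>o |elts l|"
    by (rule card_of_Plus_ordLeq_infinite_Field)
      (use l(1) in \<open>simp_all only: Field_card_of card_of_card_order_on not_False_eq_True
        finite_card_le_infinite finite.intros ordLeq_refl[OF card_of_Card_order]\<close>)
  then have A_small: "|carrier A| \<le>o |elts l|"
    using A(3) Plus_csum ordLeq_ordIso_trans ordIso_symmetric ordLeq_transitive by metis
  have "ulm_rel \<beta> \<noteq> ulm_rel \<alpha>"
  proof
    assume "ulm_rel \<beta> = ulm_rel \<alpha>"
    then have AB: "(A, B) \<in> isotype_rel ({2} \<times> elts \<beta>)" using A(2) by (simp add: ulm_rel_def)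
    note sub = isotype_relD(1)[OF AB]
    have t_div: "ulm_divisible 2 A \<delta> (h ?t)" if "\<delta> \<in> elts \<gamma>" for \<delta>
    proof -
      have "ulm_divisible 2 ?T \<delta> ?t"
        by (rule tree_elem_ulm_divisible) (use that X in \<open>auto simp: ordinal_def\<close>)
      then have "ulm_divisible 2 B \<delta> (h ?t)"
        by (rule ulm_divisible_hom[OF hom T.is_group B.is_group])
      then show ?thesis using isotype_relD(2)[OF AB] A(1) that \<beta> X by blast
    qed
    \<comment> \<open>Strict decrease at \<open>\<delta>\<close>: otherwise the preimage of $2^\delta A$ in the tree group is 2-divisible.\<close>
    have "\<exists>x\<in>carrier A. (\<forall>v\<in>elts \<delta>. ulm_divisible 2 A v x) \<and> \<not> ulm_divisible 2 A \<delta> x"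
      if \<delta>: "\<delta> \<in> elts \<gamma>" for \<delta>
    proof (rule ccontr)
      assume "\<not> ?thesis"
      then have no: "ulm_divisible 2 A \<delta> x"
        if "x \<in> carrier A" "\<forall>v\<in>elts \<delta>. ulm_divisible 2 A v x" for x using that by blast
      define D where "D = {f \<in> carrier ?T. h f \<in> carrier A \<and> (\<forall>v\<in>elts \<delta>. ulm_divisible 2 A v (h f))}"
      have "\<exists>g\<in>D. g \<otimes>\<^bsub>?T\<^esub> g = f" if f: "f \<in> D" for f
      proof -
        have "ulm_divisible 2 A \<delta> (h f)" using f no by (simp add: D_def)
        then obtain c where c: "c \<in> carrier A" "c [^]\<^bsub>A\<^esub> (2::nat) = h f" "\<forall>v\<in>elts \<delta>. ulm_divisible 2 A v c"
          by (rule ulm_divisibleE)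
        then have "c \<in> carrier B" using submodule_relD(4)[OF sub] by blast
        then obtain g where g: "g \<in> carrier ?T" "c = h g" using surj by blast
        have "h (g \<otimes>\<^bsub>?T\<^esub> g) = h g \<otimes>\<^bsub>B\<^esub> h g" using hom g(1) by (simp add: hom_mult)
        also have "\<dots> = c [^]\<^bsub>B\<^esub> (2::nat)"
          using g \<open>c \<in> carrier B\<close> by (simp only: numeral_2_eq_2 B.nat_pow_Suc B.nat_pow_0 B.l_one)
        also have "\<dots> = h f" using submodule_rel_nat_pow[OF sub c(1), of 2] c(2) by simp
        finally have "g \<otimes>\<^bsub>?T\<^esub> g = f" using inj g(1) f by (auto simp: D_def dest: inj_onD)
        then show ?thesis using g c by (auto simp: D_def)
      qed
      moreover have "D \<subseteq> carrier ?T" by (auto simp: D_def)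
      moreover have "?t \<in> D"
        using t A(1) t_div ordinal_trans[OF \<gamma>(1) \<delta>] by (auto simp: D_def)
      ultimately have "?t [\<gamma>] = 0" using tree_group_reduced[of D X ?t "[\<gamma>]"] by blast
      then show False by simp
    qed
    then obtain x where x: "\<And>\<delta>. \<delta> \<in> elts \<gamma> \<Longrightarrow> x \<delta> \<in> carrier A"
      "\<And>\<delta> v. \<delta> \<in> elts \<gamma> \<Longrightarrow> v \<in> elts \<delta> \<Longrightarrow> ulm_divisible 2 A v (x \<delta>)"
      "\<And>\<delta>. \<delta> \<in> elts \<gamma> \<Longrightarrow> \<not> ulm_divisible 2 A \<delta> (x \<delta>)" by metis
    have "inj_on x (elts \<gamma>)"
    proof (rule inj_onI, rule ccontr)
      fix \<delta> \<epsilon> assume *: "\<delta> \<in> elts \<gamma>" "\<epsilon> \<in> elts \<gamma>" "x \<delta> = x \<epsilon>" "\<delta> \<noteq> \<epsilon>"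
      then have "\<delta> \<in> elts \<epsilon> \<or> \<epsilon> \<in> elts \<delta>"
        using ordinal_linear[of \<delta> \<epsilon>] ordinal_memD[OF \<gamma>(1)] by blast
      then show False using * x(2,3) by metis
    qed
    moreover have "x ` elts \<gamma> \<subseteq> carrier A" using x(1) by blast
    ultimately have "|elts \<gamma>| \<le>o |carrier A|" using card_of_ordLeq by blast
    then have "|elts \<gamma>| \<le>o |elts l|" using A_small by (rule ordLeq_transitive)
    then show False using \<gamma>(2) not_ordLess_ordLeq by blast
  qed
  then show thesis using that \<beta> by blast
qed

text \<open>
  Since the relations get weakly stronger with the ordinal and never become constant, recursion
  over membership selects a strictly increasing subsequence: \<open>G \<alpha>\<close> is the supremum of ordinals
  at which the relation is stronger than at \<open>G \<beta>\<close>, for \<open>\<beta> \<in> \<alpha>\<close>.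
\<close>

theorem proper_class_chain:
  "\<exists>F :: 'v::set_universe \<Rightarrow> 'v monoid rel.
     (\<forall>\<alpha>. F \<alpha> \<in> LZ) \<and> (\<forall>\<alpha> \<beta>. \<alpha> \<in> elts \<beta> \<longrightarrow> less_LZ (F \<alpha>) (F \<beta>))"
proof -
  define above where "above \<alpha> = (SOME \<beta>. ordinal \<beta> \<and> elts \<alpha> \<subseteq> elts \<beta> \<and> ulm_rel \<beta> \<noteq> ulm_rel \<alpha>)"
    for \<alpha> :: 'v
  have above: "ordinal (above \<alpha>) \<and> elts \<alpha> \<subseteq> elts (above \<alpha>) \<and> ulm_rel (above \<alpha>) \<noteq> ulm_rel \<alpha>"
    if "ordinal \<alpha>" for \<alpha>
    unfolding above_def by (rule someI_ex) (use ex_stronger_ulm_rel[OF that] in metis)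
  define H where "H g \<alpha> = (SOME \<sigma>. elts \<sigma> = (\<Union>\<beta>\<in>elts \<alpha>. elts (above (g \<beta>))))"
    for g :: "'v \<Rightarrow> 'v" and \<alpha>
  define G where "G = wfrec {(x, y). x \<in> elts y} H"
  have G: "elts (G \<alpha>) = (\<Union>\<beta>\<in>elts \<alpha>. elts (above (G \<beta>)))" for \<alpha>
  proof -
    have "G \<alpha> = H (cut G {(x, y). x \<in> elts y} \<alpha>) \<alpha>" unfolding G_def by (rule wfrec[OF foundation])
    moreover have "elts (H g \<alpha>) = (\<Union>\<beta>\<in>elts \<alpha>. elts (above (g \<beta>)))" for g
      unfolding H_def by (intro small_SOME small_UN small_elts)
    ultimately have "elts (G \<alpha>) = (\<Union>\<beta>\<in>elts \<alpha>. elts (above (cut G {(x, y). x \<in> elts y} \<alpha> \<beta>)))" by simp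
    also have "\<dots> = (\<Union>\<beta>\<in>elts \<alpha>. elts (above (G \<beta>)))" by (simp add: cut_def)
    finally show ?thesis .
  qed
  have ord: "ordinal (G \<alpha>)" for \<alpha>
  proof (induction \<alpha> rule: wf_induct_rule[OF foundation])
    case (1 \<alpha>)
    then obtain \<sigma> where "ordinal \<sigma>" "elts \<sigma> = (\<Union>\<beta>\<in>elts \<alpha>. elts (above (G \<beta>)))"
      using ordinal_UN[OF small_elts, of \<alpha> "\<lambda>\<beta>. above (G \<beta>)"] above by auto
    then show ?case using G extensionality by metis
  qed
  have "less_LZ (ulm_rel (G \<alpha>)) (ulm_rel (G \<beta>))" if "\<alpha> \<in> elts \<beta>" for \<alpha> \<beta>
  proof -
    have "ulm_rel (G \<beta>) \<subseteq> ulm_rel (above (G \<alpha>))"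
      by (rule ulm_rel_antimono) (use G[of \<beta>] that in blast)
    moreover have "ulm_rel (above (G \<alpha>)) \<subset> ulm_rel (G \<alpha>)"
      using above[OF ord[of \<alpha>]] ulm_rel_antimono by blast
    ultimately show ?thesis unfolding less_LZ_def le_LZ_def by blast
  qed
  then show ?thesis
    by (intro exI[of _ "\<lambda>\<alpha>. ulm_rel (G \<alpha>)"] conjI allI impI ulm_rel_in_LZ[OF ord])
qed

text \<open>
  A set cannot bound the chain, as every set is smaller than some ordinal, along which the chain is injective.
\<close>

theorem LZ_not_small: "\<not> |LZ :: 'v::set_universe monoid rel set| \<le>o |elts (x :: 'v)|"
proof
  assume le: "|LZ :: 'v monoid rel set| \<le>o |elts x|"
  obtain F :: "'v \<Rightarrow> 'v monoid rel" where F: "\<And>\<alpha>. F \<alpha> \<in> LZ"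
    "\<And>\<alpha> \<beta>. \<alpha> \<in> elts \<beta> \<Longrightarrow> less_LZ (F \<alpha>) (F \<beta>)" using proper_class_chain by blast
  obtain \<gamma> :: 'v where \<gamma>: "ordinal \<gamma>" "|elts x| <o |elts \<gamma>|" by (rule ex_large_ordinal)
  have "inj_on F (elts \<gamma>)"
  proof (rule inj_onI, rule ccontr)
    fix \<alpha> \<beta> assume *: "\<alpha> \<in> elts \<gamma>" "\<beta> \<in> elts \<gamma>" "F \<alpha> = F \<beta>" "\<alpha> \<noteq> \<beta>"
    then have "\<alpha> \<in> elts \<beta> \<or> \<beta> \<in> elts \<alpha>"
      using ordinal_linear[of \<alpha> \<beta>] ordinal_memD[OF \<gamma>(1)] by blast
    then show False using F(2)[of \<alpha> \<beta>] F(2)[of \<beta> \<alpha>] *(3) by (auto simp: less_LZ_def)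
  qed
  then have "|elts \<gamma>| \<le>o |LZ :: 'v monoid rel set|" using F(1) card_of_ordLeq[of "elts \<gamma>"] by blast
  then have "|elts \<gamma>| \<le>o |elts x|" using le by (rule ordLeq_transitive)
  then show False using \<gamma>(2) not_ordLess_ordLeq by blast
qed

section \<open>The structure of the lattice\<close>

theorem theorem1p3:
  shows "|LZ1 :: 'v::set_universe monoid rel set| \<le>o ctwo ^c (ctwo ^c natLeq) \<and>
    (\<exists>\<A> \<subseteq> (LZ1 :: 'v monoid rel set). uncountable \<A> \<and>
       (\<forall>R\<in>\<A>. \<forall>S\<in>\<A>. R \<noteq> S \<longrightarrow> \<not> le_LZ R S)) \<and>
    (\<exists>F :: 'v \<Rightarrow> 'v monoid rel.
       (\<forall>\<alpha>. ordinal \<alpha> \<longrightarrow> F \<alpha> \<in> LZ) \<and>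
       (\<forall>\<alpha> \<beta>. ordinal \<alpha> \<longrightarrow> ordinal \<beta> \<longrightarrow> \<alpha> \<in> elts \<beta> \<longrightarrow> less_LZ (F \<alpha>) (F \<beta>))) \<and>
    (\<forall>x :: 'v. \<not> |LZ :: 'v monoid rel set| \<le>o |elts x| )"
proof (intro conjI)
  show "|LZ1 :: 'v monoid rel set| \<le>o ctwo ^c (ctwo ^c natLeq)" by (rule card_LZ1)
  show "\<exists>\<A> \<subseteq> (LZ1 :: 'v monoid rel set). uncountable \<A> \<and>
      (\<forall>R\<in>\<A>. \<forall>S\<in>\<A>. R \<noteq> S \<longrightarrow> \<not> le_LZ R S)"
    by (rule uncountable_antichain)
  obtain F :: "'v \<Rightarrow> 'v monoid rel" where "\<forall>\<alpha>. F \<alpha> \<in> LZ"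
    "\<forall>\<alpha> \<beta>. \<alpha> \<in> elts \<beta> \<longrightarrow> less_LZ (F \<alpha>) (F \<beta>)"
    using proper_class_chain by blast
  then show "\<exists>F :: 'v \<Rightarrow> 'v monoid rel.
      (\<forall>\<alpha>. ordinal \<alpha> \<longrightarrow> F \<alpha> \<in> LZ) \<and>
      (\<forall>\<alpha> \<beta>. ordinal \<alpha> \<longrightarrow> ordinal \<beta> \<longrightarrow> \<alpha> \<in> elts \<beta> \<longrightarrow> less_LZ (F \<alpha>) (F \<beta>))"
    by (intro exI[of _ F] conjI allI impI) simp_all
  show "\<forall>x :: 'v. \<not> |LZ :: 'v monoid rel set| \<le>o |elts x|" using LZ_not_small by (intro allI)
qed

end
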